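(* Let $\Gamma$ be a distance-regular graph with valency $k\geq 3$, diameter $D\geq 3$ and distinct eigenvalues $k=\theta_0>\theta_1>\cdots>\theta_D$ such that $1<\theta_1\leq 2$. Then the intersection array of $\Gamma$ is one of the following 23 arrays: $\{3,2,2;1,1,3\}$, $\{4,3,2;1,2,4\}$, $\{4,3,3;1,1,4\}$, $\{5,4,3;1,2,5\}$, $\{5,4,4;1,1,5\}$, $\{6,5,3;1,3,6\}$, $\{6,5,4;1,2,6\}$, $\{7,6,4;1,3,7\}$, $\{8,7,4;1,4,8\}$, $\{9,8,3;1,6,9\}$, $\{10,9,4;1,6,10\}$, $\{16,15,4;1,12,16\}$, $\{3,2,2,1;1,1,2,3\}$, $\{3,2,2,2;1,1,1,3\}$, $\{4,3,2,1;1,2,3,4\}$, $\{4,3,3,1;1,1,3,4\}$, $\{3,2,2,1,1;1,1,2,2,3\}$, $\{4,2,1;1,1,4\}$, $\{4,3,3;1,1,2\}$, $\{5,4,2;1,1,4\}$, $\{6,5,1;1,1,6\}$, $\{8,6,1;1,3,8\}$, $\{3,2,2,1;1,1,1,2\}$.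
   Context: All graphs are finite, simple, undirected and connected. $\Gamma$ is distance-regular with diameter $D$ if there are integers $b_i,c_i$ such that for all vertices $x,y$ with $d(x,y)=i$, $y$ has exactly $c_i$ neighbours at distance $i-1$ from $x$ and $b_i$ neighbours at distance $i+1$ from $x$; the valency is $k=b_0$. The intersection array is $\{b_0,b_1,\ldots,b_{D-1};c_1,c_2,\ldots,c_D\}$. Eigenvalues are those of the adjacency matrix. *)

theory Defs
  imports Main "HOL-Library.Extended_Nat"
begin

definition simple_graph :: "'a set \<Rightarrow> ('a \<Rightarrow> 'a \<Rightarrow> bool) \<Rightarrow> bool" where
  "simple_graph V E \<longleftrightarrow> finite V \<and> V \<noteq> {} \<and>
     (\<forall>x y. E x y \<longrightarrow> x \<in> V \<and> y \<in> V) \<and>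
     (\<forall>x y. E x y \<longrightarrow> E y x) \<and> (\<forall>x. \<not> E x x)"

fun walk :: "('a \<Rightarrow> 'a \<Rightarrow> bool) \<Rightarrow> nat \<Rightarrow> 'a \<Rightarrow> 'a \<Rightarrow> bool" where
  "walk E 0 x y = (x = y)"
| "walk E (Suc n) x y = (\<exists>z. E x z \<and> walk E n z y)"

definition graph_connected :: "'a set \<Rightarrow> ('a \<Rightarrow> 'a \<Rightarrow> bool) \<Rightarrow> bool" where
  "graph_connected V E \<longleftrightarrow> (\<forall>x\<in>V. \<forall>y\<in>V. \<exists>n. walk E n x y)"

text \<open>Path distance (meaningful in a connected graph).\<close>
definition gdist :: "('a \<Rightarrow> 'a \<Rightarrow> bool) \<Rightarrow> 'a \<Rightarrow> 'a \<Rightarrow> nat" where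
  "gdist E x y = (LEAST n. walk E n x y)"

definition diameter :: "'a set \<Rightarrow> ('a \<Rightarrow> 'a \<Rightarrow> bool) \<Rightarrow> nat" where
  "diameter V E = Max {gdist E x y | x y. x \<in> V \<and> y \<in> V}"

text \<open>Gamma is distance-regular with intersection array
  {bs!0,...,bs!(D-1); cs!0,...,cs!(D-1)} = {b_0,...,b_{D-1}; c_1,...,c_D},
  where D = length bs = length cs is the diameter.\<close>
definition distance_regular_array ::
  "'a set \<Rightarrow> ('a \<Rightarrow> 'a \<Rightarrow> bool) \<Rightarrow> nat list \<Rightarrow> nat list \<Rightarrow> bool" where
  "distance_regular_array V E bs cs \<longleftrightarrow>
     length bs = length cs \<and> diameter V E = length bs \<and>
     (\<forall>x\<in>V. \<forall>y\<in>V.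
        (gdist E x y < length bs \<longrightarrow>
           card {z. E y z \<and> gdist E x z = gdist E x y + 1} = bs ! (gdist E x y)) \<and>
        (1 \<le> gdist E x y \<longrightarrow>
           card {z. E y z \<and> gdist E x z = gdist E x y - 1} = cs ! (gdist E x y - 1)))"

definition adj_eigenvalue :: "'a set \<Rightarrow> ('a \<Rightarrow> 'a \<Rightarrow> bool) \<Rightarrow> real \<Rightarrow> bool" where
  "adj_eigenvalue V E \<theta> \<longleftrightarrow>
     (\<exists>f :: 'a \<Rightarrow> real. (\<exists>x\<in>V. f x \<noteq> 0) \<and>
        (\<forall>x\<in>V. (\<Sum>y\<in>{y\<in>V. E x y}. f y) = \<theta> * f x))"

end

theory Submission
  imports Defs Complex_Main
begin

text \<open>The eigenvalues different from the valency k are the zeros of the last term of the sequence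
  q_0 = 1, q_1 = t + 1, q_{i+1} = (t - k + b_i + c_{i+1}) q_i - b_i c_i q_{i-1}, the characteristic
  polynomials of the leading blocks of a tridiagonal matrix. If no eigenvalue lies in (2, k), a Sturm
  argument gives q_i(2) > 0 for i < D and q_D(2) \<ge> 0. For k \<ge> 5 these inequalities force D = 3,
  c_3 \<in> {k - 1, k} and b_2 \<le> 4; for k \<le> 4 they leave finitely many arrays. Integrality of the numbers
  of walks of length two, the bound k + 1 \<le> 3 a_1 for Taylor graphs and a Krein condition for antipodal
  triple covers of complete graphs eliminate all remaining infinite families. The finitely many
  other spurious arrays have an eigenvalue whose multiplicity would not be an integer.\<close>

subsection \<open>Distance-regular graphs\<close>

text \<open>Splitting off the eigenvalue k from the intersection matrix leaves a D by D tridiagonal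
  matrix with diagonal entries k - b_i - c_{i+1}. The first of them is -1, whence q_1 = t + 1. Only
  the last inequality is weak, because theta_1 = 2 is allowed. The lower bound theta_1 > 1 has one
  purpose: K_{k+1,k+1} minus a perfect matching exists for every k, has eigenvalues k, 1, -1, -k,
  and so passes every test that rests on theta_1 \<le> 2. For c_3 = k and b_2 = 1 the array is that
  of an antipodal r-fold cover of a complete graph. The Sturm inequality bounds c_2 only for r \<ge>
  4, which is why r = 2 (Taylor graphs) and r = 3 need arguments of their own. Most eigenvalues to
  be tested are irrational. Their multiplicities are never computed: a rational enclosure that
  misses all integers is enough.\<close>

lemma walk_append: "walk E m x y \<Longrightarrow> walk E n y z \<Longrightarrow> walk E (m + n) x z"
  by (induction m arbitrary: x) auto

lemma walk_rev:
  assumes "\<And>x y. E x y \<Longrightarrow> E y x"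
  shows "walk E n x y \<Longrightarrow> walk E n y x"
proof (induction n arbitrary: x)
  case (Suc n)
  then obtain z where "E x z" "walk E n z y" by auto
  then have "walk E n y z" "walk E (Suc 0) z x" using Suc.IH assms by auto
  then show ?case using walk_append[of E n y z "Suc 0" x] by simp
qed auto

locale distance_regular =
  fixes V :: "'a set" and E :: "'a \<Rightarrow> 'a \<Rightarrow> bool" and bs cs :: "nat list"
  assumes simple: "simple_graph V E"
    and connected: "graph_connected V E"
    and array: "distance_regular_array V E bs cs"
    and diam3: "length bs \<ge> 3"
begin

abbreviation d :: "'a \<Rightarrow> 'a \<Rightarrow> nat" where "d \<equiv> gdist E"
abbreviation D :: nat where "D \<equiv> length bs"

text \<open>Entries outside the array are 0, so \<open>b D\<close>, \<open>c 0\<close> and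
  \<open>c (Suc D)\<close> vanish and neighbour counts need no exceptions at either end. The
  truncated subtraction in \<open>a\<close> is exact for i \<le> D, by \<open>abc\<close>.\<close>

definition b :: "nat \<Rightarrow> nat" where "b i = (if i < D then bs ! i else 0)"
definition c :: "nat \<Rightarrow> nat" where "c i = (if 1 \<le> i \<and> i \<le> D then cs ! (i - 1) else 0)"
definition k :: nat where "k = b 0"
definition a :: "nat \<Rightarrow> nat" where "a i = k - b i - c i"

lemma finV: "finite V" and V_ne: "V \<noteq> {}"
  and E_V: "E x y \<Longrightarrow> x \<in> V \<and> y \<in> V" and E_sym: "E x y \<Longrightarrow> E y x" and E_irrefl: "\<not> E x x"
  using simple unfolding simple_graph_def by auto

lemma E_comm: "E x y \<longleftrightarrow> E y x"
  using E_sym by blast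

lemma finE [simp]: "finite {z. E y z \<and> P z}" "finite {z. E y z}"
  using finV E_V by (auto intro: finite_subset[of _ V])

lemma walk_d: "x \<in> V \<Longrightarrow> y \<in> V \<Longrightarrow> walk E (d x y) x y"
  using connected unfolding graph_connected_def gdist_def by (metis LeastI)

lemma d_le_walk: "walk E n x y \<Longrightarrow> d x y \<le> n"
  unfolding gdist_def by (rule Least_le)

lemma d_sym: "x \<in> V \<Longrightarrow> y \<in> V \<Longrightarrow> d x y = d y x"
  by (meson E_sym d_le_walk le_antisym walk_d walk_rev)

lemma d_eq_0: "x \<in> V \<Longrightarrow> y \<in> V \<Longrightarrow> d x y = 0 \<longleftrightarrow> x = y"
  using walk_d[of x y] d_le_walk[of 0 x y] by auto

lemma d_self [simp]: "d x x = 0"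
  using d_le_walk[of 0 x x] by auto

lemma d_step: "x \<in> V \<Longrightarrow> E y z \<Longrightarrow> d x z \<le> Suc (d x y)"
  using walk_append[of E "d x y" x y 1 z] walk_d[of x y] d_le_walk[of "Suc (d x y)" x z] E_V
  by fastforce

lemma d_eq_1: assumes "x \<in> V" "y \<in> V" shows "d x y = 1 \<longleftrightarrow> E x y"
proof
  assume "d x y = 1" then show "E x y" using walk_d[OF assms] by auto
next
  assume "E x y"
  then have "d x y \<le> 1" "x \<noteq> y" using d_le_walk[of 1 x y] E_irrefl by auto
  then show "d x y = 1" using d_eq_0[OF assms] by auto
qed

lemma d_cases:
  assumes "x \<in> V" "E y z"
  obtains "d x z = Suc (d x y)" | "d x z = d x y" | "Suc (d x z) = d x y"
  using d_step[OF assms(1), of y z] d_step[OF assms(1), of z y] assms(2) E_sym by fastforce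

lemma geodesic:
  assumes "x \<in> V" "y \<in> V" "d x y = Suc n"
  obtains z where "E x z" "d z y = n"
proof -
  obtain z where z: "E x z" "walk E n z y" using walk_d[OF assms(1,2)] assms(3) by auto
  have "Suc n \<le> Suc (d z y)"
    using d_step[of y z x] z assms d_sym[of x y] d_sym[of z y] E_sym E_V by auto
  then show thesis using that z d_le_walk[OF z(2)] by force
qed

lemma d_le_D: "x \<in> V \<Longrightarrow> y \<in> V \<Longrightarrow> d x y \<le> D"
  and ex_dist_D: "\<exists>x\<in>V. \<exists>y\<in>V. d x y = D"
proof -
  let ?S = "{d x y | x y. x \<in> V \<and> y \<in> V}"
  have M: "Max ?S = D"
    using array unfolding distance_regular_array_def diameter_def by simp
  have "?S = (\<lambda>(x,y). d x y) ` (V \<times> V)" by auto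
  then have fin: "finite ?S" "?S \<noteq> {}" using finV V_ne by auto
  show "x \<in> V \<Longrightarrow> y \<in> V \<Longrightarrow> d x y \<le> D"
    using Max_ge[OF fin(1), of "d x y"] M by auto
  show "\<exists>x\<in>V. \<exists>y\<in>V. d x y = D" using Max_in[OF fin] unfolding M by (smt (verit) mem_Collect_eq)
qed

lemma ex_dist: assumes "i \<le> D" shows "\<exists>x\<in>V. \<exists>y\<in>V. d x y = i"
  using assms
proof (induction rule: inc_induct)
  case base then show ?case by (rule ex_dist_D)
next
  case (step n) then show ?case using geodesic E_V by metis
qed

lemma card_b: assumes "x \<in> V" "y \<in> V" shows "card {z. E y z \<and> d x z = Suc (d x y)} = b (d x y)"
proof (cases "d x y < D")
  case True then show ?thesis
    using array assms unfolding distance_regular_array_def b_def by auto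
next
  case False
  then have "{z. E y z \<and> d x z = Suc (d x y)} = {}"
    using d_le_D[OF assms(1)] E_V by fastforce
  then show ?thesis using False by (simp add: b_def)
qed

lemma card_c: assumes "x \<in> V" "y \<in> V" shows "card {z. E y z \<and> Suc (d x z) = d x y} = c (d x y)"
proof (cases "d x y")
  case 0 then show ?thesis by (simp add: c_def)
next
  case (Suc n)
  have "{z. E y z \<and> Suc (d x z) = d x y} = {z. E y z \<and> d x z = d x y - 1}" using Suc by auto
  moreover have "card {z. E y z \<and> d x z = d x y - 1} = cs ! (d x y - 1)"
    using array assms Suc unfolding distance_regular_array_def
    by (metis One_nat_def Suc_leI zero_less_Suc)
  ultimately show ?thesis using Suc d_le_D[OF assms] unfolding c_def by simp
qed

lemma card_N: assumes "y \<in> V" shows "card {z. E y z} = k"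
proof -
  have "{z. E y z} = {z. E y z \<and> d y z = Suc (d y y)}" using d_eq_1 E_V by auto
  then show ?thesis using card_b[OF assms assms] by (simp add: k_def)
qed

lemma N_split: assumes "x \<in> V"
  shows "{z. E y z} = {z. E y z \<and> d x z = Suc (d x y)} \<union> ({z. E y z \<and> Suc (d x z) = d x y}
    \<union> {z. E y z \<and> d x z = d x y})"
  using d_cases[OF assms, of y] by blast

lemma k_split: assumes "x \<in> V" "y \<in> V"
  shows "k = b (d x y) + c (d x y) + card {z. E y z \<and> d x z = d x y}"
proof -
  have "card {z. E y z} = card {z. E y z \<and> d x z = Suc (d x y)} +
    (card {z. E y z \<and> Suc (d x z) = d x y} + card {z. E y z \<and> d x z = d x y})"
    by (subst N_split[OF assms(1), of y], subst card_Un_disjoint; (subst card_Un_disjoint)?; auto)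
  then show ?thesis using card_N card_b card_c assms by simp
qed

lemma card_a: assumes "x \<in> V" "y \<in> V" shows "card {z. E y z \<and> d x z = d x y} = a (d x y)"
  using k_split[OF assms] unfolding a_def by simp

lemma abc: assumes "i \<le> D" shows "a i + b i + c i = k"
  using ex_dist[OF assms] k_split card_a by fastforce

text \<open>The action of the intersection matrix on functions of the distance. For i = 0 the index
  \<open>i - 1\<close> does no harm because \<open>c 0 = 0\<close>.\<close>

lemma sum_N:
  fixes f :: "nat \<Rightarrow> 'b::comm_semiring_1"
  assumes "x \<in> V" "y \<in> V" and i: "d x y = i"
  shows "(\<Sum>z | E y z. f (d x z)) = of_nat (c i) * f (i - 1) + of_nat (a i) * f i + of_nat (b i) * f (Suc i)"
proof -
  have "(\<Sum>z | E y z. f (d x z)) = (\<Sum>z | E y z \<and> d x z = Suc (d x y). f (d x z)) +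
    ((\<Sum>z | E y z \<and> Suc (d x z) = d x y. f (d x z)) + (\<Sum>z | E y z \<and> d x z = d x y. f (d x z)))"
    by (subst N_split[OF assms(1), of y], subst sum.union_disjoint; (subst sum.union_disjoint)?; auto)
  also have "(\<Sum>z | E y z \<and> d x z = Suc (d x y). f (d x z)) = of_nat (b i) * f (Suc i)"
    using card_b[OF assms(1,2)] i by simp
  also have "(\<Sum>z | E y z \<and> d x z = d x y. f (d x z)) = of_nat (a i) * f i"
    using card_a[OF assms(1,2)] i by simp
  also have "(\<Sum>z | E y z \<and> Suc (d x z) = d x y. f (d x z)) = (\<Sum>z | E y z \<and> Suc (d x z) = d x y. f (i - 1))"
    using i by (intro sum.cong arg_cong[of _ _ f]) auto
  also have "\<dots> = of_nat (c i) * f (i - 1)" using card_c[OF assms(1,2)] i by simp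
  finally show ?thesis by (simp add: algebra_simps)
qed

lemma c_pos: assumes "1 \<le> i" "i \<le> D" shows "c i \<ge> 1"
proof -
  obtain x y where xy: "x \<in> V" "y \<in> V" "d x y = i" using ex_dist[OF assms(2)] by blast
  obtain n where n: "i = Suc n" using assms by (cases i) auto
  obtain z where z: "E y z" "d z x = n" using geodesic[of y x n] xy d_sym n by metis
  then have "z \<in> {z. E y z \<and> Suc (d x z) = d x y}" using xy n d_sym E_V by auto
  then have "card {z. E y z \<and> Suc (d x z) = d x y} \<noteq> 0"
    using finE(1)[of y] by (metis card_0_eq empty_iff)
  then show ?thesis using card_c[OF xy(1,2)] xy(3) by (metis Suc_leI neq0_conv One_nat_def)
qed

lemma b_pos: assumes "i < D" shows "b i \<ge> 1"
proof -
  obtain x y where xy: "x \<in> V" "y \<in> V" "d x y = Suc i" using ex_dist[of "Suc i"] assms by auto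
  obtain z where z: "E y z" "d z x = i" using geodesic[of y x i] xy d_sym by metis
  then have "y \<in> {y. E z y \<and> d x y = Suc (d x z)}" using xy d_sym E_V E_sym by auto
  then have "card {y. E z y \<and> d x y = Suc (d x z)} \<noteq> 0"
    using finE(1)[of z] by (metis card_0_eq empty_iff)
  then show ?thesis using card_b[of x z] xy(1) z d_sym E_V by (metis One_nat_def Suc_leI neq0_conv)
qed

lemma c_0 [simp]: "c 0 = 0" and b_D [simp]: "b D = 0"
  by (simp_all add: c_def b_def)

lemma c_1 [simp]: "c (Suc 0) = 1"
proof -
  obtain x y where xy: "x \<in> V" "y \<in> V" "d x y = 1" using ex_dist[of 1] diam3 by auto
  then have "{z. E y z \<and> Suc (d x z) = d x y} = {x}" using d_eq_0 d_eq_1 E_V E_sym by fastforce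
  then show ?thesis using card_c[OF xy(1,2)] xy(3) by simp
qed

lemma a_0 [simp]: "a 0 = 0"
  by (simp add: a_def k_def)

text \<open>Step from x to w along a geodesic towards y. By the triangle inequality a neighbour of y
  that is nearer to w is also nearer to x; for \<open>b_mono\<close>, one that is farther from x is
  also farther from w.\<close>

lemma c_mono: assumes "Suc i \<le> D" shows "c i \<le> c (Suc i)"
proof (cases i)
  case 0 then show ?thesis by simp
next
  case (Suc n)
  obtain x y where xy: "x \<in> V" "y \<in> V" "d x y = Suc i" using ex_dist[OF assms] by auto
  obtain w where w: "E x w" "d w y = i" using geodesic[OF xy] by blast
  then have wV: "w \<in> V" using E_V by blast
  have "{z. E y z \<and> Suc (d w z) = d w y} \<subseteq> {z. E y z \<and> Suc (d x z) = d x y}"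
  proof safe
    fix z assume z: "E y z" "Suc (d w z) = d w y"
    have zV: "z \<in> V" using z E_V by blast
    have "d z x \<le> Suc (d z w)" using d_step[OF zV, of w x] w(1) E_sym by blast
    moreover have "d x y \<le> Suc (d x z)" using d_step[OF xy(1), of z y] z(1) E_sym by blast
    ultimately show "Suc (d x z) = d x y" using z w xy zV wV d_sym by fastforce
  qed
  then have "card {z. E y z \<and> Suc (d w z) = d w y} \<le> card {z. E y z \<and> Suc (d x z) = d x y}"
    by (intro card_mono) auto
  then show ?thesis using card_c[OF wV xy(2)] card_c[OF xy(1,2)] xy(3) w(2) by metis
qed

lemma b_mono: assumes "Suc i \<le> D" shows "b (Suc i) \<le> b i"
proof -
  obtain x y where xy: "x \<in> V" "y \<in> V" "d x y = Suc i" using ex_dist[OF assms] by auto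
  obtain w where w: "E x w" "d w y = i" using geodesic[OF xy] by blast
  then have wV: "w \<in> V" using E_V by blast
  have "{z. E y z \<and> d x z = Suc (d x y)} \<subseteq> {z. E y z \<and> d w z = Suc (d w y)}"
  proof safe
    fix z assume z: "E y z" "d x z = Suc (d x y)"
    have zV: "z \<in> V" using z E_V by blast
    have "d z x \<le> Suc (d z w)" using d_step[OF zV, of w x] w(1) E_sym by blast
    moreover have "d w z \<le> Suc (d w y)" using d_step[OF wV] z(1) by blast
    ultimately show "d w z = Suc (d w y)" using z w xy zV wV d_sym by fastforce
  qed
  then have "card {z. E y z \<and> d x z = Suc (d x y)} \<le> card {z. E y z \<and> d w z = Suc (d w y)}"
    by (intro card_mono) auto
  then show ?thesis using card_b[OF wV xy(2)] card_b[OF xy(1,2)] xy(3) w(2) by metis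
qed

text \<open>Self-adjointness of the adjacency operator, over a semiring so that it serves real
  eigenfunctions as well as walk counts in \<open>nat\<close>.\<close>

lemma sum_swap:
  fixes f g :: "'a \<Rightarrow> 'b::comm_semiring_1"
  shows "(\<Sum>y\<in>V. f y * (\<Sum>z | E y z. g z)) = (\<Sum>z\<in>V. g z * (\<Sum>y | E z y. f y))"
proof -
  have *: "{z. E y z} = {z \<in> V. E y z}" for y using E_V by auto
  have "(\<Sum>y\<in>V. f y * (\<Sum>z | E y z. g z)) = (\<Sum>y\<in>V. \<Sum>z\<in>V. if E y z then f y * g z else 0)"
    unfolding * sum_distrib_left by (simp add: sum.If_cases finV Int_def)
  also have "\<dots> = (\<Sum>z\<in>V. \<Sum>y\<in>V. if E z y then f y * g z else 0)"
    by (subst sum.swap) (simp add: E_comm)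
  also have "\<dots> = (\<Sum>z\<in>V. g z * (\<Sum>y | E z y. f y))"
    unfolding * sum_distrib_left by (simp add: sum.If_cases finV Int_def mult.commute)
  finally show ?thesis .
qed

end

subsection \<open>Eigenvalues\<close>

lemma last_zero:
  fixes f :: "real \<Rightarrow> real"
  assumes cont: "continuous_on UNIV f" and "x \<le> K" "f x \<le> 0" "f K > 0"
  obtains r where "x \<le> r" "r < K" "f r = 0" "\<And>y. r < y \<Longrightarrow> y \<le> K \<Longrightarrow> f y > 0"
proof -
  let ?S = "{x..K} \<inter> {y. f y \<le> 0}"
  have "closed {y. f y \<le> 0}" using cont by (intro closed_Collect_le) auto
  then have "compact ?S" by (intro compact_Int_closed compact_Icc)
  moreover have "?S \<noteq> {}" using assms by auto
  ultimately obtain r where r: "r \<in> ?S" "\<forall>y\<in>?S. y \<le> r" using compact_attains_sup by blast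
  have rK: "r < K" using r(1) assms(4) by (cases "r = K") auto
  have pos: "f y > 0" if "r < y" "y \<le> K" for y
  proof (rule ccontr)
    assume "\<not> f y > 0"
    then have "y \<in> ?S" using r(1) that by auto
    then show False using r(2) that(1) by (meson not_le)
  qed
  have "f r = 0"
  proof (rule ccontr)
    assume "f r \<noteq> 0"
    then have "f r < 0" using r(1) by auto
    moreover have "continuous_on {r..K} f" using cont continuous_on_subset by blast
    ultimately obtain y where "r \<le> y" "y \<le> K" "f y = 0"
      using IVT'[of f r 0 K] rK assms(4) by auto
    then show False using pos[of y] \<open>f r < 0\<close> by (cases "y = r") auto
  qed
  then show thesis using that r(1) rK pos by auto
qed

text \<open>Largest zeros below K move to the right along the sequence. Where \<open>q i\<close> has
  its largest zero and \<open>q (i - 1)\<close> is positive, the recurrence makes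
  \<open>q (Suc i)\<close> negative, so the largest zero of \<open>q (Suc i)\<close> lies further
  right, where \<open>q i\<close> is positive. A first nonpositive value inside (L, K) would thus
  propagate to a zero of \<open>q D\<close> in (L, K).\<close>

lemma sturm_positive:
  fixes q :: "nat \<Rightarrow> real \<Rightarrow> real" and e :: "nat \<Rightarrow> real"
  assumes cont: "\<And>i. i \<le> D \<Longrightarrow> continuous_on UNIV (q i)"
    and q0: "\<And>x. q 0 x = 1"
    and rec: "\<And>i x. 1 \<le> i \<Longrightarrow> i < D \<Longrightarrow> q (Suc i) x = (x - t i) * q i x - e i * q (i - 1) x"
    and e: "\<And>i. 1 \<le> i \<Longrightarrow> i < D \<Longrightarrow> e i > 0"
    and K: "\<And>i. i \<le> D \<Longrightarrow> q i K > 0" and "L < K"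
    and no_zero: "\<And>x. L < x \<Longrightarrow> x < K \<Longrightarrow> q D x \<noteq> 0"
  shows "i < D \<Longrightarrow> q i L > 0" and "q D L \<ge> 0"
proof -
  have pos: "q i x > 0" if "i \<le> D" "L < x" "x < K" for i x
    using that
  proof (induction i arbitrary: x rule: less_induct)
    case (less i)
    show ?case
    proof (rule ccontr)
      assume "\<not> 0 < q i x"
      then have npos: "q i x \<le> 0" by simp
      then have i0: "i \<ge> 1" using q0[of x] by (cases i) auto
      define P where "P j \<longleftrightarrow> (\<exists>r. L < r \<and> r < K \<and> q j r = 0 \<and> (\<forall>y. r < y \<and> y \<le> K \<longrightarrow> q j y > 0)
        \<and> q (j - 1) r > 0)" for j
      obtain r where r: "x \<le> r" "r < K" "q i r = 0" "\<And>y. r < y \<Longrightarrow> y \<le> K \<Longrightarrow> q i y > 0"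
        using last_zero[OF cont[OF less.prems(1)] _ npos K[OF less.prems(1)]] less.prems by auto
      have "q (i - 1) r > 0" using less.IH[of "i - 1" r] i0 less.prems r by auto
      then have "P i" unfolding P_def using r less.prems(2) by (intro exI[of _ r]) auto
      from less.prems(1) have "P D"
      proof (induction rule: dec_induct)
        case base then show ?case by fact
      next
        case (step n)
        then obtain r where r: "L < r" "r < K" "q n r = 0" "\<And>y. r < y \<Longrightarrow> y \<le> K \<Longrightarrow> q n y > 0"
          "q (n - 1) r > 0" unfolding P_def by auto
        have n1: "1 \<le> n" "n < D" using step i0 by auto
        have neg: "q (Suc n) r < 0" using rec[OF n1, of r] r e[OF n1] by simp
        obtain s where s: "r \<le> s" "s < K" "q (Suc n) s = 0" "\<And>y. s < y \<Longrightarrow> y \<le> K \<Longrightarrow> q (Suc n) y > 0"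
          using last_zero[OF cont[of "Suc n"] _ _ K[of "Suc n"], of r] neg r(2) n1(2) by auto
        have "r < s" using s neg by (cases "r = s") auto
        then show ?case unfolding P_def using s r(1) r(4)[of s] by (intro exI[of _ s]) auto
      qed
      then show False unfolding P_def using no_zero by auto
    qed
  qed
  have nonneg: "q i L \<ge> 0" if i: "i \<le> D" for i
  proof (rule ccontr)
    assume neg: "\<not> q i L \<ge> 0"
    have "continuous_on {L..K} (q i)" using cont[OF i] continuous_on_subset by blast
    then obtain y where y: "L \<le> y" "y \<le> K" "q i y = 0"
      using IVT'[of "q i" L 0 K] neg K[OF i] \<open>L < K\<close> by auto
    then have "y \<noteq> L" "y \<noteq> K" using neg K[OF i] by auto
    then show False using pos[OF i, of y] y by auto
  qed
  then show "q D L \<ge> 0" by simp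
  \<comment> \<open>Continuity gives only nonnegativity at L. A zero before the last index would
    make the next term negative.\<close>
  show "q i L > 0" if "i < D"
    using that
  proof (induction i)
    case (Suc n)
    then have n: "q n L > 0" by simp
    show ?case
    proof (rule ccontr)
      assume "\<not> 0 < q (Suc n) L"
      then have "q (Suc n) L = 0" using nonneg[of "Suc n"] Suc.prems by simp
      then have "q (Suc (Suc n)) L < 0" using rec[of "Suc n" L] n e[of "Suc n"] Suc.prems by simp
      then show False using nonneg[of "Suc (Suc n)"] Suc.prems by simp
    qed
  qed (simp add: q0)
qed

text \<open>Peeling off the rank one projection belonging to a nonzero column lowers the trace by exactly 1.\<close>
lemma trace_idempotent_nat:
  fixes P :: "'a \<Rightarrow> 'a \<Rightarrow> real"
  assumes "finite V" and "\<And>x y. x \<in> V \<Longrightarrow> y \<in> V \<Longrightarrow> P x y = P y x"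
    and "\<And>x y. x \<in> V \<Longrightarrow> y \<in> V \<Longrightarrow> (\<Sum>z\<in>V. P x z * P z y) = P x y"
  shows "\<exists>m::nat. (\<Sum>x\<in>V. P x x) = real m"
  using assms(2,3)
proof (induction "nat \<lfloor>\<Sum>x\<in>V. P x x\<rfloor>" arbitrary: P rule: less_induct)
  case (less P)
  note sym = less.prems(1) and idem = less.prems(2)
  have diag: "P x x = (\<Sum>z\<in>V. (P x z)\<^sup>2)" if "x \<in> V" for x
    using idem[OF that that] sym[OF that] by (simp add: power2_eq_square)
  show ?case
  proof (cases "\<exists>w\<in>V. P w w \<noteq> 0")
    case False
    then show ?thesis by (intro exI[of _ 0]) simp
  next
    case True
    then obtain w where w: "w \<in> V" "P w w \<noteq> 0" by blast
    let ?p = "P w w"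
    \<comment> \<open>\<open>?p\<close> is the squared norm of the column at w, so the subtracted
      matrix is the orthogonal projection onto that column.\<close>
    define R where "R x y = P x y - P x w * P w y / ?p" for x y
    have symR: "R x y = R y x" if "x \<in> V" "y \<in> V" for x y
      using that sym w unfolding R_def by simp
    have idemR: "(\<Sum>z\<in>V. R x z * R z y) = R x y" if "x \<in> V" "y \<in> V" for x y
    proof -
      have "(\<Sum>z\<in>V. R x z * R z y) = (\<Sum>z\<in>V. P x z * P z y) - (\<Sum>z\<in>V. P x z * P z w) * P w y / ?p
        - P x w * (\<Sum>z\<in>V. P w z * P z y) / ?p + P x w * (\<Sum>z\<in>V. P w z * P z w) * P w y / ?p\<^sup>2"
        unfolding R_def sum_distrib_left sum_distrib_right sum_divide_distrib
          sum_subtractf[symmetric] sum.distrib[symmetric]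
        by (intro sum.cong) (simp_all add: algebra_simps power2_eq_square)
      also have "\<dots> = R x y" using idem that w by (simp add: R_def power2_eq_square)
      finally show ?thesis .
    qed
    have tr: "(\<Sum>x\<in>V. R x x) = (\<Sum>x\<in>V. P x x) - 1"
    proof -
      have "(\<Sum>x\<in>V. P x w * P w x) = ?p"
        using idem[OF w(1) w(1)] by (simp add: mult.commute)
      then show ?thesis unfolding R_def sum_subtractf using w(2)
        by (simp flip: sum_divide_distrib)
    qed
    have "(\<Sum>x\<in>V. R x x) \<ge> 0"
    proof (rule sum_nonneg)
      fix x assume x: "x \<in> V"
      have "R x x = (\<Sum>z\<in>V. (R x z)\<^sup>2)"
        using idemR[OF x x] symR[OF x] by (simp add: power2_eq_square)
      then show "R x x \<ge> 0" by (simp add: sum_nonneg)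
    qed
    \<comment> \<open>As the new trace is nonnegative, the old one is at least 1, so the cut-off of
      \<open>nat\<close> at 0 cannot hide the decrease.\<close>
    then have "nat \<lfloor>\<Sum>x\<in>V. R x x\<rfloor> < nat \<lfloor>\<Sum>x\<in>V. P x x\<rfloor>"
      unfolding tr by (simp add: le_floor_iff)
    then obtain m where "(\<Sum>x\<in>V. R x x) = real m" using less.hyps[of R] symR idemR by blast
    then show ?thesis using tr by (intro exI[of _ "Suc m"]) simp
  qed
qed

section \<open>Distance polynomials and eigenfunctions\<close>

context distance_regular
begin

text \<open>vs t i is the value at t of the i-th distance polynomial, which maps the adjacency matrix to
  the matrix of the relation "at distance i". Hence F t D = 0 characterizes the eigenvalues t other
  than k.\<close>
fun vs :: "real \<Rightarrow> nat \<Rightarrow> real" where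
  "vs \<theta> 0 = 1"
| "vs \<theta> (Suc 0) = \<theta>"
| "vs \<theta> (Suc (Suc i)) = ((\<theta> - real (a (Suc i))) * vs \<theta> (Suc i) - real (b i) * vs \<theta> i) / real (c (Suc (Suc i)))"

definition F :: "real \<Rightarrow> nat \<Rightarrow> real" where "F \<theta> i = (\<Sum>j\<le>i. vs \<theta> j)"

definition kk :: "nat \<Rightarrow> real" where "kk i = vs k i"

lemma real_a: "i \<le> D \<Longrightarrow> real (a i) = real k - b i - c i"
  using abc[of i] by simp

lemma vs_step:
  fixes \<theta> :: real
  assumes "Suc i < D"
  shows "c (Suc (Suc i)) * vs \<theta> (Suc (Suc i)) = (\<theta> - a (Suc i)) * vs \<theta> (Suc i) - b i * vs \<theta> i"
proof -
  have "real (c (Suc (Suc i))) \<noteq> 0" using c_pos[of "Suc (Suc i)"] assms by auto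
  then show ?thesis by simp
qed

declare vs.simps(3) [simp del]

text \<open>The three-term recurrence telescopes to first order because a_i + b_i + c_i = k. At
  theta = k this becomes the count of edges between consecutive spheres,
  \<open>kk_rec\<close>.\<close>

lemma vs_F:
  fixes \<theta> :: real
  assumes "i < D" shows "c (Suc i) * vs \<theta> (Suc i) = (\<theta> - k) * F \<theta> i + b i * vs \<theta> i"
  using assms
proof (induction i)
  case 0 then show ?case by (simp add: F_def k_def)
next
  case (Suc i)
  note vs_step[OF Suc.prems, of \<theta>]
  also have "b i * vs \<theta> i = c (Suc i) * vs \<theta> (Suc i) - (\<theta> - k) * F \<theta> i" using Suc by simp
  finally show ?case using real_a[OF less_imp_le[OF Suc.prems]] by (simp add: F_def algebra_simps)
qed

text \<open>The last row of the intersection matrix is the one that the recurrence does not enforce.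
  Its defect factors, which separates the eigenvalue k from the zeros of \<open>F\<close>.\<close>

lemma vs_last:
  fixes \<theta> :: real
  shows "(\<theta> - a D) * vs \<theta> D - b (D - 1) * vs \<theta> (D - 1) = (\<theta> - k) * F \<theta> D"
proof -
  obtain n where n: "D = Suc n" using diam3 by (cases D) auto
  then have "b n * vs \<theta> n = c D * vs \<theta> D - (\<theta> - k) * F \<theta> n" using vs_F[of n \<theta>] by simp
  moreover have "F \<theta> D = F \<theta> n + vs \<theta> D" by (simp add: F_def n)
  moreover have aD: "real (a (Suc n)) = real k - c (Suc n)" using real_a[of D] b_D by (simp flip: n)
  ultimately show ?thesis using n by (simp add: aD algebra_simps)
qed

lemma vs_rec:
  fixes \<theta> :: real
  assumes "1 \<le> i" "i \<le> D" "i = D \<Longrightarrow> \<theta> = k \<or> F \<theta> D = 0"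
  shows "c (Suc i) * vs \<theta> (Suc i) + a i * vs \<theta> i + b (i - 1) * vs \<theta> (i - 1) = \<theta> * vs \<theta> i"
proof (cases "i = D")
  case True
  then show ?thesis using vs_last[of \<theta>] assms(3) by (auto simp: c_def algebra_simps)
next
  case False
  obtain n where n: "i = Suc n" using assms by (cases i) auto
  show ?thesis using vs_step[of n \<theta>] assms False by (simp add: n algebra_simps)
qed

lemma kk_rec: assumes "i < D" shows "c (Suc i) * kk (Suc i) = b i * kk i"
  using vs_F[OF assms, of k] by (simp add: kk_def)

lemma kk_pos: "i \<le> D \<Longrightarrow> kk i > 0"
proof (induction i)
  case 0 then show ?case by (simp add: kk_def)
next
  case (Suc i)
  then have "c (Suc i) * kk (Suc i) > 0" using kk_rec[of i] b_pos[of i] by simp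
  then show ?case by (simp add: zero_less_mult_iff)
qed

definition eigenfun :: "real \<Rightarrow> ('a \<Rightarrow> real) \<Rightarrow> bool" where
  "eigenfun \<theta> g \<longleftrightarrow> (\<forall>x\<in>V. (\<Sum>y | E x y. g y) = \<theta> * g x)"

lemma adj_eigenvalue_iff: "adj_eigenvalue V E \<theta> \<longleftrightarrow> (\<exists>g. (\<exists>x\<in>V. g x \<noteq> 0) \<and> eigenfun \<theta> g)"
proof -
  have "{y \<in> V. E x y} = {y. E x y}" for x using E_V by auto
  then show ?thesis unfolding adj_eigenvalue_def eigenfun_def by simp
qed

text \<open>Moving the adjacency operator from g onto the indicator of a sphere yields the
  neighbouring spheres, so the sphere sums of g obey the recurrence of \<open>vs\<close>.\<close>

lemma sphere_sum:
  assumes g: "eigenfun \<theta> g" and x: "x \<in> V" and "i \<le> D"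
  shows "(\<Sum>y\<in>V. of_bool (d x y = i) * g y) = vs \<theta> i * g x"
proof -
  define G where "G i = (\<Sum>y\<in>V. of_bool (d x y = i) * g y)" for i
  have rec: "\<theta> * G i = c (Suc i) * G (Suc i) + a i * G i + (if i = 0 then 0 else b (i - 1) * G (i - 1))"
    for i
  proof -
    have "\<theta> * G i = (\<Sum>y\<in>V. of_bool (d x y = i) * (\<Sum>z | E y z. g z))"
      unfolding G_def sum_distrib_left using g unfolding eigenfun_def
      by (intro sum.cong) simp_all
    also have "\<dots> = (\<Sum>z\<in>V. g z * (\<Sum>y | E z y. of_bool (d x y = i)))" by (rule sum_swap)
    also have "\<dots> = (\<Sum>z\<in>V. c (Suc i) * (of_bool (d x z = Suc i) * g z) + a i * (of_bool (d x z = i) * g z)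
       + (if i = 0 then 0 else b (i - 1) * (of_bool (d x z = i - 1) * g z)))"
    proof (intro sum.cong refl)
      fix z assume z: "z \<in> V"
      show "g z * (\<Sum>y | E z y. of_bool (d x y = i)) = c (Suc i) * (of_bool (d x z = Suc i) * g z)
       + a i * (of_bool (d x z = i) * g z)
       + (if i = 0 then 0 else b (i - 1) * (of_bool (d x z = i - 1) * g z))"
        using sum_N[OF x z refl, of "\<lambda>j. of_bool (j = i) :: real"] by (cases "d x z") auto
    qed
    also have "\<dots> = c (Suc i) * G (Suc i) + a i * G i + (if i = 0 then 0 else b (i - 1) * G (i - 1))"
      unfolding G_def by (cases "i = 0") (simp_all add: sum.distrib sum_distrib_left)
    finally show ?thesis .
  qed
  have G0: "G 0 = g x"
  proof -
    have "G 0 = (\<Sum>y\<in>V. if y = x then g y else 0)"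
      unfolding G_def using d_eq_0[OF x] by (intro sum.cong) auto
    then show ?thesis using finV x by simp
  qed
  have "G i = vs \<theta> i * g x" using \<open>i \<le> D\<close>
  proof (induction i rule: less_induct)
    case (less i)
    show ?case
    proof (cases i)
      case 0 then show ?thesis by (simp add: G0)
    next
      case (Suc n)
      show ?thesis
      proof (cases n)
        case 0 then show ?thesis using rec[of 0] Suc by (simp add: G0)
      next
        case (Suc j)
        have i: "i = Suc (Suc j)" using \<open>i = Suc n\<close> Suc by simp
        have c: "real (c (Suc (Suc j))) \<noteq> 0" using c_pos[of i] less.prems i by auto
        have "c i * G i = ((\<theta> - a (Suc j)) * vs \<theta> (Suc j) - b j * vs \<theta> j) * g x"
          using rec[of "Suc j"] less.IH[of j] less.IH[of "Suc j"] less.prems i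
          by (simp add: algebra_simps)
        also have "\<dots> = c i * (vs \<theta> i * g x)"
          using vs_step[of j \<theta>] less.prems i by simp
        finally show ?thesis using c i by simp
      qed
    qed
  qed
  then show ?thesis unfolding G_def .
qed

lemma radial_sum:
  assumes g: "eigenfun \<theta> g" and x: "x \<in> V"
  shows "(\<Sum>y\<in>V. \<phi> (d x y) * g y) = (\<Sum>i\<le>D. \<phi> i * vs \<theta> i) * g x"
proof -
  have "(\<Sum>y\<in>V. \<phi> (d x y) * g y) = (\<Sum>y\<in>V. \<Sum>i\<le>D. \<phi> i * (of_bool (d x y = i) * g y))"
  proof (intro sum.cong refl)
    fix y assume "y \<in> V"
    then have "d x y \<in> {..D}" using d_le_D x by simp
    then show "\<phi> (d x y) * g y = (\<Sum>i\<le>D. \<phi> i * (of_bool (d x y = i) * g y))"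
      by (simp add: of_bool_def if_distrib[of "\<lambda>t. _ * (t * _)"] sum.delta cong: if_cong)
  qed
  also have "\<dots> = (\<Sum>i\<le>D. \<phi> i * (vs \<theta> i * g x))"
    by (subst sum.swap) (simp add: sum_distrib_left[symmetric] sphere_sum[OF g x])
  finally show ?thesis by (simp add: sum_distrib_right mult.assoc)
qed

lemma eigenfun_const: "eigenfun k (\<lambda>_. 1)"
  by (simp add: eigenfun_def card_N)

lemma radial_count: "x \<in> V \<Longrightarrow> (\<Sum>y\<in>V. \<phi> (d x y)) = (\<Sum>i\<le>D. \<phi> i * kk i)"
  using radial_sum[OF eigenfun_const, of x \<phi>] by (simp add: kk_def)

lemma sphere_card: "x \<in> V \<Longrightarrow> i \<le> D \<Longrightarrow> real (card {y \<in> V. d x y = i}) = kk i"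
  using sphere_sum[OF eigenfun_const, of x i] finV
  by (simp add: kk_def of_bool_def sum.If_cases Int_def)

lemma card_V: "real (card V) = (\<Sum>i\<le>D. kk i)"
  using radial_count[of _ "\<lambda>_. 1"] V_ne by auto

text \<open>An eigenfunction for theta other than k is orthogonal to the constants, while by
  \<open>radial_sum\<close> its sum over V is \<open>F \<theta> D\<close> times any of its
  values.\<close>

lemma eigenvalue_F:
  assumes "adj_eigenvalue V E \<theta>" "\<theta> \<noteq> k" shows "F \<theta> D = 0"
proof -
  obtain g x where g: "eigenfun \<theta> g" and x: "x \<in> V" "g x \<noteq> 0"
    using assms(1) adj_eigenvalue_iff by auto
  have "\<theta> * (\<Sum>x\<in>V. g x) = (\<Sum>x\<in>V. 1 * (\<Sum>y | E x y. g y))"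
    using g unfolding eigenfun_def by (simp add: sum_distrib_left)
  also have "\<dots> = k * (\<Sum>x\<in>V. g x)"
    by (subst sum_swap) (simp add: card_N flip: sum_distrib_right)
  finally have "(\<Sum>x\<in>V. g x) = 0" using assms(2) by simp
  then show ?thesis using radial_sum[OF g x(1), of "\<lambda>_. 1"] x(2) by (simp add: F_def)
qed

section \<open>Cosine sequences, multiplicities and the Krein condition\<close>

definition u :: "real \<Rightarrow> nat \<Rightarrow> real" where "u \<theta> i = vs \<theta> i / kk i"

text \<open>Dividing by the sphere sizes transposes the recurrence: \<open>kk_rec\<close> says that
  they symmetrize the intersection matrix. The hypothesis on \<open>F\<close> closes the last
  row.\<close>

lemma eigenfun_u:
  assumes F0: "F \<theta> D = 0" and x: "x \<in> V"
  shows "eigenfun \<theta> (\<lambda>y. u \<theta> (d x y))"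
  unfolding eigenfun_def
proof
  fix y assume y: "y \<in> V"
  define i where "i = d x y"
  have iD: "i \<le> D" using d_le_D x y i_def by simp
  have "c i * u \<theta> (i - 1) + a i * u \<theta> i + b i * u \<theta> (Suc i) = \<theta> * u \<theta> i"
  proof (cases "i = 0")
    case True
    have "D > 0" using diam3 by linarith
    then show ?thesis using True kk_rec[of 0] b_pos[of 0] by (simp add: u_def kk_def k_def)
  next
    case False
    have 1: "c i * u \<theta> (i - 1) = b (i - 1) * vs \<theta> (i - 1) / kk i"
    proof -
      have "c i * kk i = b (i - 1) * kk (i - 1)" using kk_rec[of "i - 1"] iD False by simp
      then have "c i * (vs \<theta> (i - 1) * kk i) = b (i - 1) * vs \<theta> (i - 1) * kk (i - 1)" by simp
      moreover have "kk (i - 1) > 0" "kk i > 0" using kk_pos[of "i - 1"] kk_pos[of i] iD by simp_all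
      ultimately show ?thesis
        by (auto simp: u_def divide_simps)
    qed
    have 2: "b i * u \<theta> (Suc i) = c (Suc i) * vs \<theta> (Suc i) / kk i"
    proof (cases "i = D")
      case True then show ?thesis by (simp add: c_def)
    next
      case False then show ?thesis
        using kk_rec[of i] kk_pos[of i] kk_pos[of "Suc i"] iD
        by (simp add: u_def field_simps)
    qed
    show ?thesis unfolding 1 2 using vs_rec[of i \<theta>] F0 False iD kk_pos[OF iD]
      by (simp add: u_def field_simps)
  qed
  then show "(\<Sum>z | E y z. u \<theta> (d x z)) = \<theta> * u \<theta> (d x y)"
    using sum_N[OF x y i_def[symmetric], of "u \<theta>"] i_def by simp
qed

lemma adj_eigenvalue_F: "F \<theta> D = 0 \<Longrightarrow> adj_eigenvalue V E \<theta>"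
proof -
  assume F0: "F \<theta> D = 0"
  obtain x where x: "x \<in> V" using V_ne by blast
  have "u \<theta> (d x x) \<noteq> 0" by (simp add: u_def kk_def)
  then show ?thesis using eigenfun_u[OF F0 x] x unfolding adj_eigenvalue_iff by (intro exI[of _ "\<lambda>y. u \<theta> (d x y)"] conjI bexI[of _ x])
qed

text \<open>The squared norm of the radial eigenfunction around any vertex: the sphere of radius i
  contributes \<open>kk i\<close> times the square of \<open>u \<theta> i\<close>.\<close>

definition sq_norm :: "real \<Rightarrow> real" where "sq_norm \<theta> = (\<Sum>i\<le>D. u \<theta> i * vs \<theta> i)"

lemma u_idem:
  assumes F0: "F \<theta> D = 0" and x: "x \<in> V" and y: "y \<in> V"
  shows "(\<Sum>z\<in>V. u \<theta> (d x z) * u \<theta> (d z y)) = sq_norm \<theta> * u \<theta> (d x y)"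
proof -
  have "(\<Sum>z\<in>V. u \<theta> (d x z) * u \<theta> (d z y)) = (\<Sum>z\<in>V. u \<theta> (d x z) * u \<theta> (d y z))"
    using d_sym y by (intro sum.cong) auto
  then show ?thesis
    using radial_sum[OF eigenfun_u[OF F0 y] x, of "u \<theta>"] d_sym x y by (simp add: sq_norm_def)
qed

lemma sq_norm_pos: "sq_norm \<theta> > 0"
proof -
  have "(\<Sum>i\<le>D. (vs \<theta> i)\<^sup>2 / kk i) \<ge> (\<Sum>i\<in>{0}. (vs \<theta> i)\<^sup>2 / kk i)"
    using kk_pos by (intro sum_mono2) (auto simp: less_imp_le)
  then have "sq_norm \<theta> \<ge> 1" unfolding sq_norm_def
    by (simp add: u_def kk_def power2_eq_square)
  then show ?thesis by simp
qed

text \<open>By \<open>u_idem\<close> the matrix with entries \<open>u \<theta> (d x y)\<close>,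
  divided by \<open>sq_norm \<theta>\<close>, is a symmetric idempotent with constant diagonal. Its
  trace is |V| / \<open>sq_norm \<theta>\<close>, which is Biggs' formula for the
  multiplicity.\<close>

lemma multiplicity:
  assumes F0: "F \<theta> D = 0"
  obtains m :: nat where "(\<Sum>i\<le>D. kk i) = m * sq_norm \<theta>"
proof -
  define s where "s = sq_norm \<theta>"
  have s: "s > 0" using sq_norm_pos s_def by simp
  have "\<exists>m::nat. (\<Sum>x\<in>V. u \<theta> (d x x) / s) = real m"
  proof (rule trace_idempotent_nat[OF finV, where P = "\<lambda>x y. u \<theta> (d x y) / s"])
    fix x y assume xy: "x \<in> V" "y \<in> V"
    show "u \<theta> (d x y) / s = u \<theta> (d y x) / s" using d_sym xy by simp
    have "(\<Sum>z\<in>V. u \<theta> (d x z) / s * (u \<theta> (d z y) / s)) = (\<Sum>z\<in>V. u \<theta> (d x z) * u \<theta> (d z y)) / s\<^sup>2"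
      by (simp add: sum_divide_distrib power2_eq_square)
    then show "(\<Sum>z\<in>V. u \<theta> (d x z) / s * (u \<theta> (d z y) / s)) = u \<theta> (d x y) / s"
      using u_idem[OF F0 xy] s s_def by (simp add: power2_eq_square)
  qed
  then obtain m :: nat where "(\<Sum>x\<in>V. u \<theta> (d x x) / s) = real m" by blast
  then have "real (card V) / s = real m" by (simp add: u_def kk_def)
  then show thesis using that[of m] s card_V s_def by (simp add: field_simps)
qed

text \<open>A Krein condition: the entrywise cube of a positive semidefinite matrix is again positive
  semidefinite, hence has a nonnegative sum of entries.\<close>
lemma krein:
  assumes F0: "F \<theta> D = 0"
  shows "(\<Sum>i\<le>D. u \<theta> i ^ 3 * kk i) \<ge> 0"
proof -
  let ?f = "\<lambda>x y. u \<theta> (d x y)" and ?s = "sq_norm \<theta>"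
  let ?h = "\<lambda>t x. ?f (fst t) x * (?f (fst (snd t)) x * ?f (snd (snd t)) x)"
  let ?T = "V \<times> V \<times> V"
  \<comment> \<open>\<open>?s * ?f x y\<close> is an inner product of columns. Its cube is one over
    triples of indices, so summing over x and y produces squares.\<close>
  have "?s ^ 3 * (\<Sum>x\<in>V. \<Sum>y\<in>V. ?f x y ^ 3) = (\<Sum>x\<in>V. \<Sum>y\<in>V. (?s * ?f x y) ^ 3)"
    by (simp add: sum_distrib_left power_mult_distrib)
  also have "\<dots> = (\<Sum>x\<in>V. \<Sum>y\<in>V. \<Sum>t\<in>?T. ?h t x * ?h t y)"
  proof (intro sum.cong refl)
    fix x y assume xy: "x \<in> V" "y \<in> V"
    have "?s * ?f x y = (\<Sum>z\<in>V. ?f z x * ?f z y)"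
      using u_idem[OF F0 xy] d_sym xy by (simp cong: sum.cong)
    then have "(?s * ?f x y) ^ 3 = (\<Sum>p\<in>V. ?f p x * ?f p y) * ((\<Sum>q\<in>V. ?f q x * ?f q y) *
       (\<Sum>r\<in>V. ?f r x * ?f r y))" by (simp add: power3_eq_cube)
    also have "\<dots> = (\<Sum>t\<in>?T. (?f (fst t) x * ?f (fst t) y) * ((?f (fst (snd t)) x * ?f (fst (snd t)) y)
       * (?f (snd (snd t)) x * ?f (snd (snd t)) y)))"
      by (simp add: sum_product sum.cartesian_product split_def)
    finally show "(?s * ?f x y) ^ 3 = (\<Sum>t\<in>?T. ?h t x * ?h t y)"
      by (simp add: mult.assoc mult.left_commute)
  qed
  also have "\<dots> = (\<Sum>x\<in>V. \<Sum>t\<in>?T. \<Sum>y\<in>V. ?h t x * ?h t y)"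
    by (intro sum.cong refl sum.swap)
  also have "\<dots> = (\<Sum>t\<in>?T. \<Sum>x\<in>V. \<Sum>y\<in>V. ?h t x * ?h t y)"
    by (rule sum.swap)
  also have "\<dots> = (\<Sum>t\<in>?T. (\<Sum>x\<in>V. ?h t x)\<^sup>2)"
    by (simp add: power2_eq_square sum_product)
  also have "\<dots> \<ge> 0" by (intro sum_nonneg) simp
  finally have "(\<Sum>x\<in>V. \<Sum>y\<in>V. ?f x y ^ 3) \<ge> 0"
    using sq_norm_pos[of \<theta>] by (simp add: zero_le_mult_iff)
  moreover have "(\<Sum>x\<in>V. \<Sum>y\<in>V. ?f x y ^ 3) = card V * (\<Sum>i\<le>D. u \<theta> i ^ 3 * kk i)"
    using radial_count[of _ "\<lambda>i. u \<theta> i ^ 3"] by simp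
  ultimately show ?thesis using finV V_ne by (simp add: zero_le_mult_iff card_gt_0_iff)
qed

section \<open>The Sturm sequence at 2\<close>

lemma F_rec: 
  fixes \<theta> :: real
  assumes "1 \<le> i" "i < D"
  shows "c (Suc i) * F \<theta> (Suc i) = (\<theta> - k + b i + c (Suc i)) * F \<theta> i - b i * F \<theta> (i - 1)"
proof -
  obtain n where n: "i = Suc n" using assms by (cases i) auto
  have "F \<theta> (Suc i) = F \<theta> i + vs \<theta> (Suc i)" "F \<theta> i = F \<theta> (i - 1) + vs \<theta> i"
    by (simp_all add: F_def n)
  then show ?thesis using vs_F[OF assms(2), of \<theta>] by (simp add: algebra_simps)
qed

text \<open>Clearing the denominators makes the polynomials monic, with the recurrence that
  \<open>sturm_positive\<close> expects.\<close>

definition q :: "nat \<Rightarrow> real \<Rightarrow> real" where "q i \<theta> = (\<Prod>j<i. real (c (Suc j))) * F \<theta> i"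

lemma q_rec:
  assumes "1 \<le> i" "i < D"
  shows "q (Suc i) \<theta> = (\<theta> - (real k - b i - c (Suc i))) * q i \<theta> - real (b i * c i) * q (i - 1) \<theta>"
proof -
  obtain n where n: "i = Suc n" using assms by (cases i) auto
  have "q (Suc i) \<theta> = (\<Prod>j<i. real (c (Suc j))) * (c (Suc i) * F \<theta> (Suc i))"
    by (simp add: q_def)
  then show ?thesis unfolding F_rec[OF assms] by (simp add: q_def n algebra_simps)
qed

text \<open>Integer values, so that the search can compute with them; the 3 is t + 1 at t =
  2.\<close>

fun Q :: "nat \<Rightarrow> int" where
  "Q 0 = 1"
| "Q (Suc 0) = 3"
| "Q (Suc (Suc i)) = (2 - int k + int (b (Suc i)) + int (c (Suc (Suc i)))) * Q (Suc i)
     - int (b (Suc i)) * int (c (Suc i)) * Q i"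

lemma q_2: "i \<le> D \<Longrightarrow> q i 2 = of_int (Q i)"
proof (induction i rule: Q.induct)
  case 1 show ?case by (simp add: q_def F_def)
next
  case 2 show ?case by (simp add: q_def F_def)
next
  case (3 i) then show ?case using q_rec[of "Suc i" 2] by (simp add: algebra_simps)
qed

lemma vs_cont: "continuous_on UNIV (\<lambda>x. vs x i)"
proof (induction i rule: less_induct)
  case (less i)
  consider "i = 0" | "i = Suc 0" | n where "i = Suc (Suc n)" by (metis not0_implies_Suc)
  then show ?case
    by cases (auto simp: vs.simps(3) divide_inverse intro!: continuous_intros less)
qed

text \<open>The Sturm argument between 2 and k: at k all terms are positive multiples of sums of
  sphere sizes, and a zero of \<open>q D\<close> strictly between would be an eigenvalue.\<close>

lemma Q_pos:
  assumes "k \<ge> 3" and "\<And>\<mu>. adj_eigenvalue V E \<mu> \<Longrightarrow> \<mu> < k \<Longrightarrow> \<mu> \<le> 2"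
  shows "i < D \<Longrightarrow> Q i > 0" and "Q D \<ge> 0"
proof -
  have cont: "continuous_on UNIV (q i)" for i
    unfolding q_def F_def by (intro continuous_intros vs_cont)
  have Fk: "F k i > 0" if "i \<le> D" for i
    using kk_pos that unfolding F_def kk_def by (intro sum_pos) auto
  have qk: "q i k > 0" if "i \<le> D" for i
    unfolding q_def using Fk[OF that] c_pos that
    by (intro mult_pos_pos prod_pos) (auto simp: Suc_le_eq)
  have pos: "real (b i * c i) > 0" if "1 \<le> i" "i < D" for i
    using b_pos[of i] c_pos[of i] that by simp
  have nz: "q D x \<noteq> 0" if "2 < x" "x < k" for x :: real
  proof -
    have "real (c (Suc j)) \<noteq> 0" if "j < D" for j using c_pos[of "Suc j"] that by simp
    then have "(\<Prod>j<D. real (c (Suc j))) \<noteq> 0" by (simp add: prod_zero_iff)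
    then show ?thesis using adj_eigenvalue_F[of x] assms(2)[of x] that by (auto simp: q_def)
  qed
  have q0: "q 0 x = 1" for x by (simp add: q_def F_def)
  have lt: "(2::real) < k" using assms(1) by simp
  note st = sturm_positive[of D q, OF cont q0 q_rec pos qk lt nz]
  show "i < D \<Longrightarrow> Q i > 0" using st(1)[of i] q_2[of i] by simp
  show "Q D \<ge> 0" using st(2) q_2[of D] by simp
qed

text \<open>P i h is the intersection number commonly written with upper index i and lower indices 1, h.\<close>
definition P :: "nat \<Rightarrow> nat \<Rightarrow> nat" where
  "P i h = (if h = Suc i then b i else if h = i then a i else if Suc h = i then c i else 0)"

section \<open>Walks of length two, sphere sizes, Taylor graphs\<close>

lemma card_P:
  assumes "x \<in> V" "y \<in> V"
  shows "(\<Sum>z | E y z. of_bool (d x z = h)) = P (d x y) h"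
  using sum_N[OF assms refl, of "\<lambda>j. of_bool (j = h) :: nat"] by (cases "d x y") (auto simp: P_def)

text \<open>Counts walks of length two from y to vertices at distance h from x, where
  \<open>d x y = i\<close>. The left side groups them by middle vertex, the right side by end
  vertex: y itself, a neighbour of y, or a vertex at distance 2 from y is reached k, a_1 or c_2
  times. Here n is the number of end vertices of the last kind, so the equation is a divisibility
  condition on c_2.\<close>

lemma two_walks:
  assumes "i \<le> D"
  shows "\<exists>n. c i * P (i - 1) h + a i * P i h + b i * P (Suc i) h
    = k * of_bool (i = h) + a 1 * P i h + c 2 * n"
proof -
  obtain x y where xy: "x \<in> V" "y \<in> V" "d x y = i" using ex_dist[OF assms] by blast
  have set: "{z. E y z} = {z \<in> V. E y z}" for y using E_V by auto
  have common: "(\<Sum>z | E w z. of_bool (E y z)) = k * of_bool (w = y) + a 1 * of_bool (E y w)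
      + c 2 * of_bool (d y w = 2)" if w: "w \<in> V" for w
  proof -
    have "(\<Sum>z | E w z. of_bool (E y z)) = (\<Sum>z | E w z. of_bool (d y z = 1) :: nat)"
      using d_eq_1[OF xy(2)] E_V by (intro sum.cong) auto
    also have "\<dots> = P (d y w) 1" using card_P[OF xy(2) w] .
    also have "\<dots> = k * of_bool (d y w = 0) + a 1 * of_bool (d y w = 1) + c 2 * of_bool (d y w = 2)"
      by (auto simp: P_def k_def numeral_2_eq_2)
    finally show ?thesis using d_eq_0[OF xy(2) w] d_eq_1[OF xy(2) w] by auto
  qed
  have "c i * P (i - 1) h + a i * P i h + b i * P (Suc i) h = (\<Sum>z | E y z. P (d x z) h)"
    using sum_N[OF xy, of "\<lambda>j. P j h"] by simp
  also have "\<dots> = (\<Sum>z\<in>V. of_bool (E y z) * (\<Sum>w | E z w. of_bool (d x w = h)))"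
  proof -
    have "(\<Sum>z | E y z. f z) = (\<Sum>z\<in>V. of_bool (E y z) * f z)" for f :: "'a \<Rightarrow> nat"
      unfolding set sum.inter_filter[OF finV] by (intro sum.cong) auto
    then show ?thesis using card_P[OF xy(1)] by simp
  qed
  also have "\<dots> = (\<Sum>w\<in>V. of_bool (d x w = h) * (\<Sum>z | E w z. of_bool (E y z)))"
    by (rule sum_swap)
  also have "\<dots> = (\<Sum>w\<in>V. k * (if w = y then of_bool (d x w = h) else 0)
      + a 1 * (if E y w then of_bool (d x w = h) else 0) + c 2 * of_bool (d x w = h \<and> d y w = 2))"
  proof (intro sum.cong refl)
    fix w assume w: "w \<in> V"
    show "of_bool (d x w = h) * (\<Sum>z | E w z. of_bool (E y z))
      = k * (if w = y then of_bool (d x w = h) else 0)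
      + a 1 * (if E y w then of_bool (d x w = h) else 0) + c 2 * of_bool (d x w = h \<and> d y w = 2)"
      unfolding common[OF w] by simp
  qed
  also have "\<dots> = k * of_bool (d x y = h) + a 1 * (\<Sum>w | E y w. of_bool (d x w = h))
      + c 2 * (\<Sum>w\<in>V. of_bool (d x w = h \<and> d y w = 2))"
    using finV xy(2) unfolding set sum.distrib
    by (simp add: sum.If_cases Int_def flip: sum_distrib_left)
  also have "\<dots> = k * of_bool (i = h) + a 1 * P i h + c 2 * (\<Sum>w\<in>V. of_bool (d x w = h \<and> d y w = 2))"
    using card_P[OF xy(1,2)] xy(3) by simp
  finally show ?thesis by blast
qed

text \<open>A counterpart of \<open>kk\<close> in \<open>nat\<close>, for divisibility; by
  \<open>card_sphere\<close> the base vertex is arbitrary.\<close>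

definition sphere :: "nat \<Rightarrow> nat" where
  "sphere i = card {y \<in> V. d (SOME x. x \<in> V) y = i}"

lemma card_sphere: assumes "x \<in> V" "i \<le> D" shows "card {y \<in> V. d x y = i} = sphere i"
proof -
  have "(SOME x. x \<in> V) \<in> V" using V_ne by (meson ex_in_conv someI_ex)
  then have "real (sphere i) = kk i" using sphere_card assms(2) unfolding sphere_def by simp
  then show ?thesis using sphere_card[OF assms] by simp
qed

lemma kk_sphere: "i \<le> D \<Longrightarrow> kk i = real (sphere i)"
  using card_sphere sphere_card V_ne by force

lemma sphere_0 [simp]: "sphere 0 = 1"
  using kk_sphere[of 0] by (simp add: kk_def)

lemma sphere_rec: "i < D \<Longrightarrow> c (Suc i) * sphere (Suc i) = b i * sphere i"
  using kk_rec[of i] kk_sphere[of i] kk_sphere[of "Suc i"] by (simp flip: of_nat_mult)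

lemma sphere_1: "sphere (Suc 0) = k"
  using sphere_rec[of 0] diam3 by (cases "0 < D") (auto simp: k_def)

text \<open>A Taylor graph: for a triangle xyz, antipodes of the vertices adjacent to x but neither to
  y nor to z are common neighbours of y and z.\<close>
lemma taylor_bound:
  assumes D3: "D = 3" and c3: "c 3 = k" and b2: "b 2 = 1" and c2: "c 2 = b 1" and a1: "a 1 \<ge> 1"
  shows "k + 1 \<le> 3 * a 1"
proof -
  have "sphere 2 = k"
    using sphere_rec[of 1] sphere_1 c2 b_pos[of 1] D3 by (simp add: numeral_2_eq_2)
  then have s3: "sphere 3 = 1"
    using sphere_rec[of 2] c3 b2 D3 c_pos[of 3] by (simp add: numeral_3_eq_3 numeral_2_eq_2)
  have anti: "\<exists>!w. w \<in> V \<and> d x w = 3" if "x \<in> V" for x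
  proof -
    have "card {w \<in> V. d x w = 3} = 1" using card_sphere[OF that, of 3] s3 D3 by simp
    then obtain w where "{w \<in> V. d x w = 3} = {w}" using card_1_singletonE by blast
    then show ?thesis by (intro ex1I[of _ w]) blast+
  qed
  define op where "op x = (THE w. w \<in> V \<and> d x w = 3)" for x
  have op: "op x \<in> V" "d x (op x) = 3" if "x \<in> V" for x
    using theI'[OF anti[OF that]] unfolding op_def by auto
  have op_eq: "w = op x" if "x \<in> V" "w \<in> V" "d x w = 3" for x w
    using anti[OF that(1)] op[OF that(1)] that by blast
  \<comment> \<open>\<open>b 2 = 1\<close> leaves y a single neighbour at distance 3 from w, which
    can only be the antipode of w.\<close>
  have op_nbr: "E y (op w)" if yw: "y \<in> V" "w \<in> V" "d w y = 2" for y w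
  proof -
    have "card {z. E y z \<and> d w z = Suc (d w y)} = 1" using card_b[OF yw(2,1)] yw(3) b2 by simp
    then obtain z where "E y z" "d w z = 3" using yw(3)
      by (metis (mono_tags, lifting) card_1_singletonE insertI1 mem_Collect_eq numeral_2_eq_2 numeral_3_eq_3)
    then show ?thesis using op_eq[of w z] yw E_V by auto
  qed
  have inj_op: "inj_on op V"
  proof (rule inj_onI)
    fix v w assume "v \<in> V" "w \<in> V" "op v = op w"
    then show "v = w" using op op_eq[of "op v" v] op_eq[of "op w" w] d_sym by metis
  qed
  have common: "card {w. E x w \<and> E y w} = a 1" if "E x y" for x y
  proof -
    have V: "x \<in> V" "y \<in> V" using that E_V by auto
    have "{w. E x w \<and> E y w} = {w. E y w \<and> d x w = d x y}"
      using d_eq_1[OF V(1)] that E_V by (metis V)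
    then show ?thesis using card_a[OF V] d_eq_1[OF V] that by simp
  qed
  obtain x y where xy: "E x y" using ex_dist[of 1] d_eq_1 D3 by auto
  have "{w. E x w \<and> E y w} \<noteq> {}" using common[OF xy] a1 by (metis card.empty not_one_le_zero)
  then obtain z where z: "E x z" "E y z" by blast
  have V: "x \<in> V" "y \<in> V" "z \<in> V" using xy z E_V by auto
  have ne: "y \<noteq> z" "x \<noteq> y" "x \<noteq> z" using xy z E_irrefl by auto
  define W where "W = {w. E x w} - ({w. E x w \<and> E y w} \<union> {w. E x w \<and> E z w})"
  have yz: "y \<notin> {w. E x w \<and> E y w}" "y \<in> {w. E x w \<and> E z w}" "z \<in> {w. E x w \<and> E y w}"
    "z \<notin> {w. E x w \<and> E z w}" using xy z E_irrefl E_sym by auto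
  have WV: "W \<subseteq> V" unfolding W_def using E_V by auto
  have cN: "card {w. E x w} \<le> card W + card ({w. E x w \<and> E y w} \<union> {w. E x w \<and> E z w})"
    unfolding W_def by (rule order.trans[OF card_mono card_Un_le]) auto
  have le: "k \<le> card W + (a 1 + a 1)"
    using cN card_Un_le[of "{w. E x w \<and> E y w}" "{w. E x w \<and> E z w}"]
      common[OF xy] common[OF z(1)] card_N[OF V(1)] by linarith
  \<comment> \<open>The common neighbour x is missed, since every w in W is adjacent to x and so has
    another antipode. Hence k - 2 a_1 \<le> |W| \<le> a_1 - 1.\<close>
  have "op ` W \<subseteq> {w. E y w \<and> E z w} - {x}"
  proof
    fix v assume "v \<in> op ` W"
    then obtain w where w: "w \<in> W" "v = op w" by auto
    have wV: "w \<in> V" using w WV by auto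
    have wx: "E x w" "\<not> E y w" "\<not> E z w" using w(1) unfolding W_def by auto
    have "w \<noteq> y" "w \<noteq> z" using wx xy z E_sym by auto
    have dd: "d w y \<le> 2" "d w z \<le> 2" 
      using d_step[OF wV, of x y] d_step[OF wV, of x z] xy z(1) d_eq_1[OF wV V(1)] wx(1) E_sym by auto
    have "d w y = 2"
      using dd(1) d_eq_0[OF wV V(2)] d_eq_1[OF wV V(2)] \<open>w \<noteq> y\<close> wx E_sym by fastforce
    moreover have "d w z = 2"
      using dd(2) d_eq_0[OF wV V(3)] d_eq_1[OF wV V(3)] \<open>w \<noteq> z\<close> wx E_sym by fastforce
    ultimately show "v \<in> {w. E y w \<and> E z w} - {x}"
      using op_nbr V wV w(2) op[OF wV] d_eq_1[OF wV V(1)] wx(1) E_sym by auto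
  qed
  then have "card (op ` W) \<le> card ({w. E y w \<and> E z w} - {x})" by (intro card_mono) auto
  moreover have "card (op ` W) = card W" using inj_op WV by (metis card_image inj_on_subset)
  moreover have "card ({w. E y w \<and> E z w} - {x}) = a 1 - 1"
    using common[OF z(2)] xy z E_sym by (subst card_Diff_singleton) auto
  ultimately have "k \<le> (a 1 - 1) + (a 1 + a 1)" using le by simp
  then show ?thesis using a1 by simp
qed

text \<open>Error radius of \<open>vs\<close> when t is perturbed by at most e: the same recurrence
  with absolute values. It is rational for rational t and e, even if the enclosed eigenvalue is
  not.\<close>

fun rad :: "real \<Rightarrow> real \<Rightarrow> nat \<Rightarrow> real" where
  "rad t e 0 = 0"
| "rad t e (Suc 0) = e"
| "rad t e (Suc (Suc i)) = ((\<bar>t - real (a (Suc i))\<bar> + e) * rad t e (Suc i) + e * \<bar>vs t (Suc i)\<bar>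
     + real (b i) * rad t e i) / real (c (Suc (Suc i)))"

lemma vs_rad: assumes "\<bar>\<theta> - t\<bar> \<le> e" shows "\<bar>vs \<theta> i - vs t i\<bar> \<le> rad t e i"
proof (induction i rule: less_induct)
  case (less i)
  consider "i = 0" | "i = Suc 0" | n where "i = Suc (Suc n)" by (metis not0_implies_Suc)
  then show ?case
  proof cases
    case 3
    let ?x = "vs \<theta> (Suc n) - vs t (Suc n)" and ?y = "vs \<theta> n - vs t n" and ?a = "real (a (Suc n))"
    have IH: "\<bar>?x\<bar> \<le> rad t e (Suc n)" "\<bar>?y\<bar> \<le> rad t e n" using less[of n] less[of "Suc n"] 3 by auto
    have "(\<theta> - ?a) * vs \<theta> (Suc n) - b n * vs \<theta> n - ((t - ?a) * vs t (Suc n) - b n * vs t n)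
      = (\<theta> - ?a) * ?x + (\<theta> - t) * vs t (Suc n) - b n * ?y" by (simp add: algebra_simps)
    also have "\<bar>\<dots>\<bar> \<le> \<bar>\<theta> - ?a\<bar> * \<bar>?x\<bar> + \<bar>\<theta> - t\<bar> * \<bar>vs t (Suc n)\<bar> + b n * \<bar>?y\<bar>"
    proof -
      have "\<bar>b n * ?y\<bar> = b n * \<bar>?y\<bar>" by (simp add: abs_mult)
      then show ?thesis unfolding abs_mult[symmetric] by linarith
    qed
    also have "\<dots> \<le> (\<bar>t - ?a\<bar> + e) * rad t e (Suc n) + e * \<bar>vs t (Suc n)\<bar> + b n * rad t e n"
      using IH assms by (intro add_mono mult_mono) auto
    finally show ?thesis unfolding 3 vs.simps(3) rad.simps(3) diff_divide_distrib[symmetric] abs_divide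
      by (simp add: divide_right_mono)
  qed (use assms in auto)
qed

text \<open>S - R and S + R enclose the norm of the eigenvector of some eigenvalue in [t - e, t + e], so its
  multiplicity would lie strictly between N and N + 1.\<close>
lemma multiplicity_contradiction:
  fixes t e S R :: real and N :: nat
  assumes "e \<ge> 0" and sgn: "F (t - e) D * F (t + e) D \<le> 0"
    and S: "S = (\<Sum>i\<le>D. (vs t i)\<^sup>2 / kk i)"
    and R: "R = (\<Sum>i\<le>D. rad t e i * (2 * \<bar>vs t i\<bar> + rad t e i) / kk i)"
    and "N * (S + R) < (\<Sum>i\<le>D. kk i)" and "(\<Sum>i\<le>D. kk i) < (N + 1) * (S - R)"
  shows False
proof -
  have cont: "continuous_on {t - e..t + e} (\<lambda>x. F x D)"
    unfolding F_def by (intro continuous_intros continuous_on_subset[OF vs_cont]) auto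
  obtain \<theta> where \<theta>: "t - e \<le> \<theta>" "\<theta> \<le> t + e" "F \<theta> D = 0"
  proof -
    have "F (t - e) D \<le> 0 \<and> 0 \<le> F (t + e) D \<or> F (t + e) D \<le> 0 \<and> 0 \<le> F (t - e) D"
      using sgn by (auto simp: mult_le_0_iff)
    then show thesis
      using IVT'[of "\<lambda>x. F x D" "t - e" 0 "t + e"] IVT2'[of "\<lambda>x. F x D" "t + e" 0 "t - e"] cont that assms(1)
      by auto
  qed
  \<comment> \<open>Factor the difference of squares: one factor is at most the radius, the other at
    most \<open>2 * \<bar>vs t i\<bar>\<close> plus the radius.\<close>
  have diff: "\<bar>u \<theta> i * vs \<theta> i - (vs t i)\<^sup>2 / kk i\<bar> \<le> rad t e i * (2 * \<bar>vs t i\<bar> + rad t e i) / kk i"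
    if "i \<le> D" for i
  proof -
    have r: "\<bar>vs \<theta> i - vs t i\<bar> \<le> rad t e i" using vs_rad \<theta> by auto
    have "(vs \<theta> i)\<^sup>2 - (vs t i)\<^sup>2 = (vs \<theta> i - vs t i) * (vs \<theta> i + vs t i)"
      by (simp add: power2_eq_square algebra_simps)
    then have "\<bar>(vs \<theta> i)\<^sup>2 - (vs t i)\<^sup>2\<bar> \<le> rad t e i * (2 * \<bar>vs t i\<bar> + rad t e i)"
      using r by (simp add: abs_mult) (intro mult_mono, auto)
    then show ?thesis using kk_pos[OF that]
      by (simp add: u_def diff_divide_distrib[symmetric] divide_right_mono power2_eq_square)
  qed
  have "\<bar>sq_norm \<theta> - S\<bar> \<le> R"
    unfolding sq_norm_def S R sum_subtractf[symmetric]
    by (rule order.trans[OF sum_abs sum_mono]) (use diff in auto)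
  moreover obtain m :: nat where "(\<Sum>i\<le>D. kk i) = m * sq_norm \<theta>" using multiplicity[OF \<theta>(3)] .
  ultimately have 1: "real N * (S + R) < m * sq_norm \<theta>" "m * sq_norm \<theta> < (1 + real N) * (S - R)"
    "sq_norm \<theta> \<le> S + R" "S - R \<le> sq_norm \<theta>" using assms(5,6) by auto
  have "real N * sq_norm \<theta> \<le> real N * (S + R)" "(1 + real N) * (S - R) \<le> (1 + real N) * sq_norm \<theta>"
    using 1 by (auto intro!: mult_left_mono)
  then have "real N * sq_norm \<theta> < m * sq_norm \<theta>" "m * sq_norm \<theta> < (1 + real N) * sq_norm \<theta>"
    using 1 by linarith+
  then have "real N < real m" "real m < real (Suc N)" using sq_norm_pos[of \<theta>] by auto
  then have "N < m" "m < Suc N" by (simp_all only: of_nat_less_iff)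
  then show False by simp
qed

end

subsection \<open>Exclusion of arrays\<close>

text \<open>One search step; q' and q are consecutive values of \<open>Q\<close>, and s is the last
  sphere size. The ranges of b and c encode monotonicity, the divisibility makes the next sphere
  size integral, and the generator for r acts as a let. A branch with q \<le> 0 stops because only
  the final value may vanish.\<close>

fun extend :: "nat \<Rightarrow> nat list \<times> nat list \<times> int \<times> int \<times> nat \<Rightarrow> (nat list \<times> nat list \<times> int \<times> int \<times> nat) list"
  where "extend k (B, C, q', q, s) = (if q \<le> 0 then [] else
    [(b # B, c # C, q, r, s * b div c).
      b \<leftarrow> [1..<Suc (hd B)], c \<leftarrow> [hd C..<Suc k],
      r \<leftarrow> [(2 - int k + int b + int c) * q - int b * int (hd C) * q'],
      b + hd C \<le> k \<and> c dvd s * b \<and> r \<ge> 0])"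

text \<open>Candidates for the first entries of an intersection array with valency k, in reverse order,
  together with the last two terms of the Sturm sequence at 2 and the size of the last sphere.\<close>
fun partial_arrays where
  "partial_arrays k 0 = [([k], [1], 1, 3, k)]"
| "partial_arrays k (Suc n) = concat (map (extend k) (partial_arrays k n))"

definition small_arrays :: "(nat list \<times> nat list) list" where
  "small_arrays = [
    ([3, 1, 1], [1, 1, 3]), ([3, 2, 1], [1, 1, 1]), ([3, 2, 1], [1, 1, 2]),
    ([3, 2, 1, 1], [1, 1, 2, 3]), ([3, 2, 1], [1, 1, 3]), ([3, 2, 2], [1, 1, 1]),
    ([3, 2, 2, 1], [1, 1, 1, 2]), ([3, 2, 2, 1], [1, 1, 1, 3]), ([3, 2, 2, 2], [1, 1, 1, 3]),
    ([3, 2, 2], [1, 1, 2]), ([3, 2, 2, 1], [1, 1, 2, 2]), ([3, 2, 2, 1, 1], [1, 1, 2, 2, 3]),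
    ([3, 2, 2, 1], [1, 1, 2, 3]), ([3, 2, 2], [1, 1, 3]), ([3, 2, 1], [1, 2, 3]),
    ([4, 2, 1], [1, 1, 4]), ([4, 2, 1], [1, 2, 4]), ([4, 2, 2], [1, 2, 4]),
    ([4, 3, 1], [1, 1, 2]), ([4, 3, 1], [1, 1, 3]), ([4, 3, 1, 1], [1, 1, 3, 4]),
    ([4, 3, 1], [1, 1, 4]), ([4, 3, 2], [1, 1, 2]), ([4, 3, 2], [1, 1, 3]),
    ([4, 3, 2, 1], [1, 1, 3, 4]), ([4, 3, 2], [1, 1, 4]), ([4, 3, 3], [1, 1, 2]),
    ([4, 3, 3], [1, 1, 3]), ([4, 3, 3, 1], [1, 1, 3, 4]), ([4, 3, 3], [1, 1, 4]),
    ([4, 3, 1], [1, 2, 2]), ([4, 3, 1], [1, 2, 3]), ([4, 3, 2], [1, 2, 2]),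
    ([4, 3, 2], [1, 2, 3]), ([4, 3, 2, 1], [1, 2, 3, 4]), ([4, 3, 2], [1, 2, 4]),
    ([4, 3, 1], [1, 3, 4])]"

text \<open>Level n holds n + 1 entries on each side. An empty level 5 therefore bounds the diameter
  by 5, and levels 2, 3, 4 below are the diameters 3, 4, 5.\<close>

lemma partial_arrays_empty: "list_all (\<lambda>k. partial_arrays k 5 = []) [3, 4]"
  by code_simp

lemma partial_arrays_small:
  "list_all (\<lambda>k. list_all (\<lambda>n. list_all (\<lambda>(B, C, _). (rev B, rev C) \<in> set small_arrays)
     (partial_arrays k n)) [2, 3, 4]) [3, 4]"
  by code_simp

text \<open>The finite part of \<open>arithmetic_1\<close>, where c_3 = k and b_2 \<ge> 2. Here
  \<open>k - b2 - c2\<close> is a_2 and \<open>k - 1 - a1\<close> is b_1; the last two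
  divisibilities say that the spheres of radius 2 and 3 have integral size.\<close>

lemma finite_check_1:
  "list_all (\<lambda>k. list_all (\<lambda>a1. list_all (\<lambda>b2. list_all (\<lambda>c2.
     b2 + c2 \<le> k \<longrightarrow> (2 + b2) * (k + 2 * a1) \<le> 6 * c2 + 4 * (2 + b2) \<longrightarrow> a1 \<le> k - b2 - c2 \<longrightarrow>
     c2 dvd (k - b2 - c2 - a1) * b2 \<longrightarrow> c2 dvd k * (b2 - 1) \<longrightarrow> c2 dvd (k - 1 - a1) * (k - b2 - c2) \<longrightarrow>
     c2 dvd k * (k - 1 - a1) \<longrightarrow> k dvd (k * (k - 1 - a1) div c2) * b2 \<longrightarrow>
     (k, k - 1 - a1, b2, c2) \<in> set [(5,4,2,1), (5,4,3,1), (5,4,3,2), (5,4,4,1), (6,5,2,2),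
       (6,5,3,3), (6,5,4,2), (7,6,4,3), (8,7,4,4), (9,8,3,6), (10,9,4,6), (16,15,4,12)])
     [1..k - b2]) [2, 3, 4]) [0, 1]) [5..20::int]"
  by code_simp

text \<open>The counterpart for \<open>arithmetic_2\<close>, where c_3 = k - 1 and a_3 = 1.\<close>

lemma finite_check_2:
  "list_all (\<lambda>k. list_all (\<lambda>a1. list_all (\<lambda>b2. list_all (\<lambda>c2.
     b2 + c2 \<le> k \<longrightarrow> (1 + b2) * (k + 2 * a1) \<le> 3 * c2 + 4 * (1 + b2) \<longrightarrow> a1 \<le> k - b2 - c2 + 1 \<longrightarrow>
     c2 dvd (k - b2 - c2 + 1 - a1) * b2 \<longrightarrow> c2 dvd (k - 1 - a1) * (k - b2 - c2) \<longrightarrow>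
     c2 dvd (k - 1) * b2 + 1 - (k + a1) \<longrightarrow>
     c2 dvd k * (k - 1 - a1) \<longrightarrow> (k - 1) dvd (k * (k - 1 - a1) div c2) * b2 \<longrightarrow>
     (k, k - 1 - a1, b2, c2) \<in> set [(5,4,2,1), (5,4,2,2)])
     [1..k - b2]) [2, 3]) [0, 1]) [5..7::int]"
  by code_simp

context distance_regular
begin

lemma array3:
  assumes "bs = [x0, x1, x2]" "cs = [y1, y2, y3]"
  shows "length bs = Suc (Suc (Suc 0))" "b 0 = x0" "b (Suc 0) = x1" "b (Suc (Suc 0)) = x2"
    "c (Suc (Suc 0)) = y2" "c (Suc (Suc (Suc 0))) = y3"
  unfolding b_def c_def by (simp_all add: assms)

lemma array4:
  assumes "bs = [x0, x1, x2, x3]" "cs = [y1, y2, y3, y4]"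
  shows "length bs = Suc (Suc (Suc (Suc 0)))" "b 0 = x0" "b (Suc 0) = x1" "b (Suc (Suc 0)) = x2"
    "b (Suc (Suc (Suc 0))) = x3" "c (Suc (Suc 0)) = y2" "c (Suc (Suc (Suc 0))) = y3"
    "c (Suc (Suc (Suc (Suc 0)))) = y4"
  unfolding b_def c_def by (simp_all add: assms)

lemmas array_eval = F_def vs.simps(3) kk_def a_def k_def power2_eq_square

text \<open>For each array, t and e enclose one eigenvalue, located by a sign change of
  \<open>F\<close>, and N is the integer part of its would-be multiplicity. With e = 0 the number t
  is itself an eigenvalue.\<close>

lemma multiplicity_excludes:
  assumes "(bs, cs) \<in> {
    ([3,2,1], [1,1,1]), ([3,2,1], [1,1,2]), ([3,2,1,1], [1,1,2,3]), ([3,2,1], [1,1,3]),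
    ([3,2,2], [1,1,1]), ([3,2,2,1], [1,1,1,3]), ([3,2,2], [1,1,2]), ([3,2,2,1], [1,1,2,2]),
    ([4,3,1], [1,1,2]), ([4,3,1], [1,1,3]), ([4,3,1,1], [1,1,3,4]), ([4,3,1], [1,1,4]),
    ([4,3,2], [1,1,2]), ([4,3,2], [1,1,3]), ([4,3,2,1], [1,1,3,4]), ([4,3,2], [1,1,4]),
    ([4,3,3], [1,1,3]), ([4,3,2], [1,2,2]), ([5,4,3], [1,1,5]), ([5,4,2], [1,1,5]),
    ([6,5,2], [1,2,6]), ([7,6,1], [1,2,7]), ([10,9,1], [1,3,10]), ([5,4,1], [1,1,5]),
    ([5,4,1], [1,2,5]), ([7,6,1], [1,3,7]), ([6,4,1], [1,2,6]), ([5,4,1], [1,1,4]),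
    ([5,4,2], [1,2,4])}"
  shows False
proof -
  note M = multiplicity_contradiction[OF _ _ refl refl]
  have 1: False if "bs = [3, 2, 1]" "cs = [1, 1, 1]"
    by (rule M[where t = "1/4" and e = "1/16" and N = 5]) (simp_all add: array3[OF that] array_eval)
  have 2: False if "bs = [3, 2, 1]" "cs = [1, 1, 2]"
    by (rule M[where t = "-1/3" and e = "1/30" and N = 3]) (simp_all add: array3[OF that] array_eval)
  have 3: False if "bs = [3, 2, 1, 1]" "cs = [1, 1, 2, 3]"
    by (rule M[where t = "7/4" and e = "1/32" and N = 3]) (simp_all add: array4[OF that] array_eval)
  have 4: False if "bs = [3, 2, 1]" "cs = [1, 1, 3]"
    by (rule M[where t = "-7/3" and e = "1/30" and N = 2]) (simp_all add: array3[OF that] array_eval)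
  have 5: False if "bs = [3, 2, 2]" "cs = [1, 1, 1]"
    by (rule M[where t = "9/5" and e = "1/40" and N = 7]) (simp_all add: array3[OF that] array_eval)
  have 6: False if "bs = [3, 2, 2, 1]" "cs = [1, 1, 1, 3]"
    by (rule M[where t = "0" and e = "0" and N = 7]) (simp_all add: array4[OF that] array_eval)
  have 7: False if "bs = [3, 2, 2]" "cs = [1, 1, 2]"
    by (rule M[where t = "-13/5" and e = "1/20" and N = 2]) (simp_all add: array3[OF that] array_eval)
  have 8: False if "bs = [3, 2, 2, 1]" "cs = [1, 1, 2, 2]"
    by (rule M[where t = "1/2" and e = "1/40" and N = 4]) (simp_all add: array4[OF that] array_eval)
  have 9: False if "bs = [4, 3, 1]" "cs = [1, 1, 2]"
    by (rule M[where t = "2" and e = "0" and N = 6]) (simp_all add: array3[OF that] array_eval)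
  have 10: False if "bs = [4, 3, 1]" "cs = [1, 1, 3]"
    by (rule M[where t = "-1/4" and e = "1/16" and N = 4]) (simp_all add: array3[OF that] array_eval)
  have 11: False if "bs = [4, 3, 1, 1]" "cs = [1, 1, 3, 4]"
    by (rule M[where t = "2" and e = "0" and N = 5]) (simp_all add: array4[OF that] array_eval)
  have 12: False if "bs = [4, 3, 1]" "cs = [1, 1, 4]"
    by (rule M[where t = "11/7" and e = "1/56" and N = 9]) (simp_all add: array3[OF that] array_eval)
  have 13: False if "bs = [4, 3, 2]" "cs = [1, 1, 2]"
    by (rule M[where t = "2" and e = "0" and N = 10]) (simp_all add: array3[OF that] array_eval)
  have 14: False if "bs = [4, 3, 2]" "cs = [1, 1, 3]"
    by (rule M[where t = "9/5" and e = "1/40" and N = 10]) (simp_all add: array3[OF that] array_eval)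
  have 15: False if "bs = [4, 3, 2, 1]" "cs = [1, 1, 3, 4]"
    by (rule M[where t = "1/3" and e = "1/15" and N = 6]) (simp_all add: array4[OF that] array_eval)
  have 16: False if "bs = [4, 3, 2]" "cs = [1, 1, 4]"
    by (rule M[where t = "5/3" and e = "1/30" and N = 10]) (simp_all add: array3[OF that] array_eval)
  have 17: False if "bs = [4, 3, 3]" "cs = [1, 1, 3]"
    by (rule M[where t = "-17/5" and e = "1/20" and N = 2]) (simp_all add: array3[OF that] array_eval)
  have 18: False if "bs = [4, 3, 2]" "cs = [1, 2, 2]"
    by (rule M[where t = "2" and e = "0" and N = 4]) (simp_all add: array3[OF that] array_eval)
  have 19: False if "bs = [5, 4, 3]" "cs = [1, 1, 5]"
    by (rule M[where t = "-4" and e = "1/12" and N = 2]) (simp_all add: array3[OF that] array_eval)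
  have 20: False if "bs = [5, 4, 2]" "cs = [1, 1, 5]"
    by (rule M[where t = "-8/5" and e = "1/40" and N = 11]) (simp_all add: array3[OF that] array_eval)
  have 21: False if "bs = [6, 5, 2]" "cs = [1, 2, 6]"
    by (rule M[where t = "-17/4" and e = "1/12" and N = 3]) (simp_all add: array3[OF that] array_eval)
  have 22: False if "bs = [7, 6, 1]" "cs = [1, 2, 7]"
    by (rule M[where t = "-23/6" and e = "1/48" and N = 7]) (simp_all add: array3[OF that] array_eval)
  have 23: False if "bs = [10, 9, 1]" "cs = [1, 3, 10]"
    by (rule M[where t = "2" and e = "0" and N = 23]) (simp_all add: array3[OF that] array_eval)
  have 24: False if "bs = [5, 4, 1]" "cs = [1, 1, 5]"
    by (rule M[where t = "9/5" and e = "1/40" and N = 14]) (simp_all add: array3[OF that] array_eval)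
  have 25: False if "bs = [5, 4, 1]" "cs = [1, 2, 5]"
    by (rule M[where t = "10/7" and e = "1/28" and N = 8]) (simp_all add: array3[OF that] array_eval)
  have 26: False if "bs = [7, 6, 1]" "cs = [1, 3, 7]"
    by (rule M[where t = "-9/2" and e = "1/24" and N = 4]) (simp_all add: array3[OF that] array_eval)
  have 27: False if "bs = [6, 4, 1]" "cs = [1, 2, 6]"
    by (rule M[where t = "2" and e = "0" and N = 8]) (simp_all add: array3[OF that] array_eval)
  have 28: False if "bs = [5, 4, 1]" "cs = [1, 1, 4]"
    by (rule M[where t = "-1/4" and e = "1/16" and N = 5]) (simp_all add: array3[OF that] array_eval)
  have 29: False if "bs = [5, 4, 2]" "cs = [1, 2, 4]"
    by (rule M[where t = "-1" and e = "0" and N = 8]) (simp_all add: array3[OF that] array_eval)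
  show False
    using assms
    by (elim insertE emptyE Pair_inject)
      (erule (1) 1 2 3 4 5 6 7 8 9 10 11 12 13 14 15 16 17 18 19 20 21 22 23 24
25 26 27 28 29)+
qed

end

section \<open>Arithmetic for diameter three and valency at least five\<close>

lemma arithmetic_1:
  fixes k a1 a2 b1 b2 c2 n1 n2 n3 s2 s3 :: nat
  assumes k5: "k \<ge> 5" and k1: "k = 1 + a1 + b1" and k2: "k = a2 + b2 + c2"
    and b2: "b2 \<ge> 1" and c2: "c2 \<ge> 1"
    and ineq: "(2 + b2) * (k + 2 * a1) \<le> 6 * c2 + 4 * (2 + b2)"
    and e1: "a2 * b2 = a1 * b2 + c2 * n1"
    and e2: "k * b2 = k + c2 * n2"
    and e3: "b1 * a2 = c2 * n3"
    and e4: "k * b1 = c2 * s2" and e5: "s2 * b2 = k * s3"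
  shows "b2 = 1 \<and> b1 = c2 \<or> b2 = 1 \<and> b1 = 2 * c2 \<and> a1 \<le> 1 \<or>
    (k, b1, b2, c2) \<in> {(5,4,2,1), (5,4,3,1), (5,4,3,2), (5,4,4,1), (6,5,2,2), (6,5,3,3), (6,5,4,2),
      (7,6,4,3), (8,7,4,4), (9,8,3,6), (10,9,4,6), (16,15,4,12), (7,6,1,2), (10,9,1,3), (5,4,1,1),
      (6,5,1,1)}"
proof (cases "b2 = 1")
  case True
  then have a2: "a2 = a1 + c2 * n1" using e1 by simp
  \<comment> \<open>This is the array of an antipodal cover of the complete graph on k + 1 vertices
    with index n1 + 2. Indices 2 and 3 are the two infinite families in the conclusion.\<close>
  then have b1: "b1 = c2 * n1 + c2" using k1 k2 True by simp
  have le: "3 * a1 + c2 * n1 \<le> c2 + 3" using ineq True k1 b1 by simp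
  consider "n1 = 0" | "n1 = 1" | "n1 \<ge> 2" by linarith
  then show ?thesis
  proof cases
    case 3
    have "c2 * 2 \<le> c2 * n1" using 3 by (intro mult_le_mono2)
    then have "c2 \<le> 3" using le by linarith
    then have "c2 \<in> {1, 2, 3}" using c2 by auto
    then show ?thesis
    proof (elim insertE emptyE)
      assume [simp]: "c2 = 1"
      have "a1 = 0" "n1 \<in> {2, 3, 4}" using le 3 by auto
      then show ?thesis using k1 b1 k5 True by auto
    next
      assume [simp]: "c2 = 2"
      have "a1 = 0" "n1 = 2" using le 3 by auto
      then show ?thesis using k1 b1 k5 True by auto
    next
      assume [simp]: "c2 = 3"
      have "a1 = 0" "n1 = 2" using le 3 by auto
      then show ?thesis using k1 b1 k5 True by auto
    qed
  qed (use le b1 True in auto)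
next
  case False
  \<comment> \<open>As c_2 \<le> k - b_2, the right side of \<open>ineq\<close> is at most 6 k + 8 -
    2 b_2, whereas b_2 \<ge> 5 makes the left side at least 7 k.\<close>
  have "b2 \<le> 4"
  proof (rule ccontr)
    assume "\<not> b2 \<le> 4"
    then have "7 * (k + 2 * a1) \<le> (2 + b2) * (k + 2 * a1)" by (intro mult_le_mono1) simp
    then show False using ineq k2 \<open>\<not> b2 \<le> 4\<close> by simp
  qed
  then have b2': "b2 \<in> {2, 3, 4}" using b2 False by auto
  \<comment> \<open>Since c_2 < k, the equation c_2 n2 = k (b_2 - 1) forces n2 \<ge> b_2, hence c_2
    \<le> k (b_2 - 1) / b_2. With \<open>ineq\<close> this bounds k by 16, 20, 16 for b_2 = 2, 3,
    4.\<close>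
  have bound: "k \<le> 20 \<and> a1 \<le> 1"
    using b2'
  proof (elim insertE emptyE)
    assume [simp]: "b2 = 2"
    have "n2 \<noteq> 0" "n2 \<noteq> 1" using e2 k2 k5 by (auto intro: ccontr)
    then have "c2 * 2 \<le> c2 * n2" by (intro mult_le_mono2) simp
    moreover have "c2 * n2 = k" using e2 by simp
    ultimately have "2 * c2 \<le> k" by simp
    moreover have "4 * (k + 2 * a1) \<le> 6 * c2 + 16" using ineq by simp
    ultimately show ?thesis using c2 k5 by arith
  next
    assume [simp]: "b2 = 3"
    have "n2 \<noteq> 0" "n2 \<noteq> 1" "n2 \<noteq> 2" using e2 k2 k5 by (auto intro: ccontr)
    then have "c2 * 3 \<le> c2 * n2" by (intro mult_le_mono2) simp
    moreover have "c2 * n2 = 2 * k" using e2 by simp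
    ultimately have "3 * c2 \<le> 2 * k" by simp
    moreover have "5 * (k + 2 * a1) \<le> 6 * c2 + 20" using ineq by simp
    ultimately show ?thesis using c2 k5 by arith
  next
    assume [simp]: "b2 = 4"
    have "n2 \<noteq> 0" "n2 \<noteq> 1" "n2 \<noteq> 2" "n2 \<noteq> 3" using e2 k2 k5 by (auto intro: ccontr)
    then have "c2 * 4 \<le> c2 * n2" by (intro mult_le_mono2) simp
    moreover have "c2 * n2 = 3 * k" using e2 by simp
    ultimately have "4 * c2 \<le> 3 * k" by simp
    moreover have "6 * (k + 2 * a1) \<le> 6 * c2 + 24" using ineq by simp
    ultimately show ?thesis using k2 c2 k5 by arith
  qed
  have a12: "a1 \<le> a2"
  proof -
    have "a1 * b2 \<le> a2 * b2" using e1 by simp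
    then show ?thesis using b2 by simp
  qed
  have d1: "int c2 dvd (int a2 - a1) * b2"
  proof -
    have "(int a2 - a1) * b2 = int c2 * n1"
      using arg_cong[OF e1, of int] by (simp add: algebra_simps)
    then show ?thesis by simp
  qed
  have d2: "int c2 dvd int k * (int b2 - 1)"
  proof -
    have "int k * (int b2 - 1) = int c2 * n2"
      using arg_cong[OF e2, of int] by (simp add: algebra_simps)
    then show ?thesis by simp
  qed
  have d3: "int c2 dvd int b1 * a2" "int c2 dvd int k * b1"
    using e3 e4 by (simp_all flip: of_nat_mult)
  have d4: "int k dvd (int k * b1 div c2) * b2"
  proof -
    have "int k * b1 div c2 = s2" using arg_cong[OF e4, of int] c2 by simp
    then have "(int k * b1 div c2) * b2 = int k * s3" using arg_cong[OF e5, of int] by simp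
    then show ?thesis by simp
  qed
  have i: "int a2 = int k - b2 - c2" "int b1 = int k - 1 - a1" using k1 k2 by simp_all
  have "5 \<le> int k \<and> int k \<le> 20" "1 \<le> int c2 \<and> int c2 \<le> int k - int b2" using k5 bound c2 k2 by simp_all
  then have mem: "int k \<in> set [5..20]" "int a1 \<in> set [0, 1]" "int b2 \<in> set [2, 3, 4]"
    "int c2 \<in> set [1..int k - int b2]"
    using bound b2' by (simp_all only: set_upto atLeastAtMost_iff) auto
  have "int b2 + int c2 \<le> int k" using k2 by simp
  moreover have "(2 + int b2) * (int k + 2 * int a1) \<le> 6 * int c2 + 4 * (2 + int b2)"
  proof -
    have "int ((2 + b2) * (k + 2 * a1)) \<le> int (6 * c2 + 4 * (2 + b2))" using ineq by (simp only: of_nat_le_iff)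
    then show ?thesis by (simp only: of_nat_add of_nat_mult of_nat_numeral of_nat_1)
  qed
  moreover have "int a1 \<le> int k - b2 - c2" using a12 k2 by simp
  moreover note d1 d2 d3 d4
  ultimately have "(int k, int k - 1 - a1, int b2, int c2) \<in> set [(5,4,2,1), (5,4,3,1), (5,4,3,2),
       (5,4,4,1), (6,5,2,2), (6,5,3,3), (6,5,4,2), (7,6,4,3), (8,7,4,4), (9,8,3,6), (10,9,4,6), (16,15,4,12)]"
    unfolding i by (rule finite_check_1[unfolded list_all_iff, rule_format, OF mem])
  then show ?thesis unfolding i[symmetric] by auto
qed

text \<open>The case c_3 = k - 1, a_3 = 1. As in \<open>arithmetic_1\<close>, \<open>ineq\<close> is
  \<open>Q 3 \<ge> 0\<close>, the equations \<open>e1\<close> to \<open>e3\<close> come from walks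
  of length two, and \<open>e4\<close> and \<open>e5\<close> from sphere sizes.\<close>

lemma arithmetic_2:
  fixes k a1 a2 b1 b2 c2 n1 n2 n3 s2 s3 :: nat
  assumes k5: "k \<ge> 5" and k1: "k = 1 + a1 + b1" and k2: "k = a2 + b2 + c2"
    and b2: "b2 \<ge> 1" and c2: "c2 \<ge> 1"
    and ineq: "(1 + b2) * (k + 2 * a1) \<le> 3 * c2 + 4 * (1 + b2)"
    and e1: "a2 * b2 + b2 = a1 * b2 + c2 * n1"
    and e2: "(k - 1) * b2 + 1 = k + a1 + c2 * n2"
    and e3: "b1 * a2 = c2 * n3"
    and e4: "k * b1 = c2 * s2" and e5: "s2 * b2 = (k - 1) * s3"
  shows "(k, b1, b2, c2) \<in> {(5,4,1,1), (5,4,2,1), (5,4,2,2)}"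
proof (cases "b2 = 1")
  case True
  then have a1: "a1 = 0" using e2 k5 by simp
  then have b1: "b1 = k - 1" using k1 by simp
  have "k * (k - 1) = c2 * s3 * (k - 1)" using e4 e5 True b1 by (simp only:) (simp add: ac_simps)
  moreover have "k - 1 \<noteq> 0" using k5 by simp
  ultimately have k: "k = c2 * s3" by (metis mult_cancel2)
  \<comment> \<open>c_2 divides b_1 a_2 = (k - 1) (k - 1 - c_2), hence also (k - 1)^2. Since it
    divides k as well, it is 1.\<close>
  have "(k - 1) * a2 + (k - 1) * c2 = (k - 1) * (k - 1)"
    using k2 True by (simp flip: add_mult_distrib2)
  then have "c2 dvd (k - 1) * (k - 1)" using e3 b1
    by (metis dvd_add dvd_triv_left dvd_triv_right)
  moreover have "c2 dvd k * (k - 2)" using k by simp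
  moreover have "(k - 1) * (k - 1) = k * (k - 2) + 1"
  proof -
    obtain j where "k = 2 + j" using k5 le_Suc_ex[of 2 k] by auto
    then show ?thesis by (simp add: algebra_simps)
  qed
  ultimately have "c2 dvd 1" by (metis dvd_add_right_iff)
  then have "c2 = 1" by simp
  moreover have "k = 5" using ineq True a1 \<open>c2 = 1\<close> k5 by simp
  ultimately show ?thesis using True b1 by simp
next
  case False
  \<comment> \<open>From c_2 \<le> k - b_2 and b_2 \<le> k the right side of \<open>ineq\<close> is
    at most 4 k + 4, which is below 5 k.\<close>
  have "b2 \<le> 3"
  proof (rule ccontr)
    assume "\<not> b2 \<le> 3"
    then have "5 * (k + 2 * a1) \<le> (1 + b2) * (k + 2 * a1)" by (intro mult_le_mono1) simp
    moreover have "(1 + b2) * 4 + 3 * c2 \<le> 3 * k + 4 + b2" using k2 by simp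
    moreover have "b2 \<le> k" using k2 by simp
    ultimately show False using ineq k5 \<open>\<not> b2 \<le> 3\<close> by simp
  qed
  then have b2': "b2 \<in> {2, 3}" using b2 False by auto
  have bound: "k \<le> 7 \<and> a1 \<le> 1"
    using b2'
  proof (elim insertE emptyE)
    assume [simp]: "b2 = 2"
    have le: "k + 2 * a1 \<le> c2 + 4" using ineq by simp
    then have a1: "a1 \<le> 1" using k2 by simp
    have n2: "k - 1 - a1 = c2 * n2" using e2 k5 by simp
    consider "n2 = 0" | "n2 = 1" | "n2 \<ge> 2" by linarith
    then show ?thesis
    proof cases
      case 2
      then have "a1 = 1" "a2 = 0" "c2 = k - 2" using n2 k2 a1 k5 by simp_all
      then have "c2 = b1" "b1 \<noteq> 0" using k1 k5 by simp_all
      \<comment> \<open>With c_2 = b_1 the second sphere has k vertices, so k - 1 divides 2 k and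
        therefore 2.\<close>
      then have "b1 * k = b1 * s2" using e4 by (simp add: mult.commute)
      then have "k = s2" using \<open>b1 \<noteq> 0\<close> by (metis mult_cancel1)
      then have "k * 2 = (k - 1) * s3" using e5 by simp
      then have "(k - 1) * 2 + 2 = (k - 1) * s3" using k5 by simp
      then have "k - 1 dvd 2" by (metis dvd_add_right_iff dvd_triv_left)
      then show ?thesis using k5 by (auto dest: dvd_imp_le)
    next
      case 3
      then have "c2 * 2 \<le> c2 * n2" by (intro mult_le_mono2)
      then have "2 * c2 \<le> k - 1 - a1" unfolding n2 by simp
      then show ?thesis using le a1 by arith
    qed (use n2 a1 k5 in simp)
  next
    assume [simp]: "b2 = 3"
    show ?thesis using ineq k2 by simp
  qed
  have a12: "a1 \<le> a2 + 1"
  proof -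
    have "a1 * b2 \<le> (a2 + 1) * b2" using e1 by simp
    then show ?thesis using b2 by (metis mult_le_cancel2 not_one_le_zero gr0I)
  qed
  have d1: "int c2 dvd (int a2 + 1 - a1) * b2"
  proof -
    have "(int a2 + 1 - a1) * b2 = int c2 * n1"
      using arg_cong[OF e1, of int] by (simp add: algebra_simps)
    then show ?thesis by simp
  qed
  have d2: "int c2 dvd (int k - 1) * b2 + 1 - (int k + a1)"
  proof -
    have "(int k - 1) * b2 + 1 - (int k + a1) = int c2 * n2"
      using arg_cong[OF e2, of int] k5 by (simp add: of_nat_diff)
    then show ?thesis by simp
  qed
  have d3: "int c2 dvd int b1 * a2" "int c2 dvd int k * b1"
    using e3 e4 by (simp_all flip: of_nat_mult)
  have d4: "(int k - 1) dvd (int k * b1 div c2) * b2"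
  proof -
    have "int k * b1 div c2 = s2" using arg_cong[OF e4, of int] c2 by simp
    then have "(int k * b1 div c2) * b2 = (int k - 1) * s3"
      using arg_cong[OF e5, of int] k5 by (simp add: of_nat_diff)
    then show ?thesis by simp
  qed
  have i: "int a2 = int k - b2 - c2" "int b1 = int k - 1 - a1" using k1 k2 by simp_all
  have "5 \<le> int k \<and> int k \<le> 7" "1 \<le> int c2 \<and> int c2 \<le> int k - int b2" using k5 bound c2 k2 by simp_all
  then have mem: "int k \<in> set [5..7]" "int a1 \<in> set [0, 1]" "int b2 \<in> set [2, 3]"
    "int c2 \<in> set [1..int k - int b2]"
    using bound b2' by (simp_all only: set_upto atLeastAtMost_iff) auto
  have "int b2 + int c2 \<le> int k" using k2 by simp
  moreover have "(1 + int b2) * (int k + 2 * int a1) \<le> 3 * int c2 + 4 * (1 + int b2)"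
  proof -
    have "int ((1 + b2) * (k + 2 * a1)) \<le> int (3 * c2 + 4 * (1 + b2))" using ineq by (simp only: of_nat_le_iff)
    then show ?thesis by (simp only: of_nat_add of_nat_mult of_nat_numeral of_nat_1)
  qed
  moreover have "int a1 \<le> int k - b2 - c2 + 1" using a12 k2 by simp
  moreover note d1 d3(1) d2 d3(2) d4
  ultimately have "(int k, int k - 1 - a1, int b2, int c2) \<in> set [(5,4,2,1), (5,4,2,2)]"
    unfolding i by (rule finite_check_2[unfolded list_all_iff, rule_format, OF mem])
  then show ?thesis unfolding i[symmetric] by auto
qed

subsection \<open>Classification\<close>

definition admissible_arrays :: "(nat list \<times> nat list) set" where
  "admissible_arrays = {
    ([3,2,2], [1,1,3]), ([4,3,2], [1,2,4]), ([4,3,3], [1,1,4]), ([5,4,3], [1,2,5]),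
    ([5,4,4], [1,1,5]), ([6,5,3], [1,3,6]), ([6,5,4], [1,2,6]), ([7,6,4], [1,3,7]),
    ([8,7,4], [1,4,8]), ([9,8,3], [1,6,9]), ([10,9,4], [1,6,10]), ([16,15,4], [1,12,16]),
    ([3,2,2,1], [1,1,2,3]), ([3,2,2,2], [1,1,1,3]), ([4,3,2,1], [1,2,3,4]),
    ([4,3,3,1], [1,1,3,4]), ([3,2,2,1,1], [1,1,2,2,3]), ([4,2,1], [1,1,4]),
    ([4,3,3], [1,1,2]), ([5,4,2], [1,1,4]), ([6,5,1], [1,1,6]), ([8,6,1], [1,3,8]),
    ([3,2,2,1], [1,1,1,2])}"

lemma extend_mem:
  assumes "q > 0" "1 \<le> b" "b \<le> hd B" "hd C \<le> c" "c \<le> k" "b + hd C \<le> k" "c dvd s * b"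
    and r: "r = (2 - int k + int b + int c) * q - int b * int (hd C) * q'" "r \<ge> 0" "t = s * b div c"
  shows "(b # B, c # C, q, r, t) \<in> set (extend k (B, C, q', q, s))"
proof -
  have "b \<in> set [1..<Suc (hd B)]" "c \<in> set [hd C..<Suc k]" using assms by (simp_all del: upt_Suc)
  then show ?thesis using assms(1,6,7,9) unfolding r(1,3)
  by (simp del: upt_Suc set_upt)
qed

locale small_second_eigenvalue = distance_regular +
  assumes k3: "k \<ge> 3"
    and le_2: "\<And>\<mu>. adj_eigenvalue V E \<mu> \<Longrightarrow> \<mu> < k \<Longrightarrow> \<mu> \<le> 2"
    and ex_gt_1: "\<exists>\<theta>. adj_eigenvalue V E \<theta> \<and> 1 < \<theta> \<and> \<theta> < k"
begin

lemmas Q_pos' = Q_pos[OF k3 le_2]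

lemma bs_eq: "bs = map b [0..<D]" and cs_eq: "cs = map c [1..<Suc D]"
proof -
  have l: "length cs = D" using array unfolding distance_regular_array_def by simp
  show "bs = map b [0..<D]" by (rule nth_equalityI) (simp_all add: b_def)
  show "cs = map c [1..<Suc D]" using l by (intro nth_equalityI) (simp_all add: c_def del: upt_Suc)
qed

text \<open>Soundness of the search: every leading segment of the actual array passes the filters of
  \<open>extend\<close>. The lists are reversed because the search adds entries at the
  front.\<close>

lemma in_partial_arrays:
  assumes "n < D"
  shows "(rev (map b [0..<Suc n]), rev (map c [1..<Suc (Suc n)]), Q n, Q (Suc n), sphere (Suc n))
    \<in> set (partial_arrays k n)"
  using assms
proof (induction n)
  case 0
  then show ?case by (simp add: sphere_1) (simp add: k_def)
next
  case (Suc n)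
  let ?B = "rev (map b [0..<Suc n])" and ?C = "rev (map c [1..<Suc (Suc n)])"
  have s: "c (Suc (Suc n)) * sphere (Suc (Suc n)) = sphere (Suc n) * b (Suc n)"
    using sphere_rec[of "Suc n"] Suc.prems by (simp add: mult.commute)
  have hd: "hd ?B = b n" "hd ?C = c (Suc n)" by simp_all
  have "(b (Suc n) # ?B, c (Suc (Suc n)) # ?C, Q (Suc n), Q (Suc (Suc n)), sphere (Suc (Suc n)))
    \<in> set (extend k (?B, ?C, Q n, Q (Suc n), sphere (Suc n)))"
  proof (rule extend_mem, unfold hd)
    show "Q (Suc n) > 0" using Q_pos'(1)[of "Suc n"] Suc.prems by simp
    show "Q (Suc (Suc n)) \<ge> 0"
      using Q_pos'(1)[of "Suc (Suc n)"] Q_pos'(2) Suc.prems by (cases "Suc (Suc n) = D") auto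
    show "1 \<le> b (Suc n)" "b (Suc n) \<le> b n" "c (Suc n) \<le> c (Suc (Suc n))"
      using b_pos[of "Suc n"] b_mono[of n] c_mono[of "Suc n"] Suc.prems by simp_all
    show "c (Suc (Suc n)) \<le> k" "b (Suc n) + c (Suc n) \<le> k"
      using abc[of "Suc (Suc n)"] abc[of "Suc n"] Suc.prems by simp_all
    show "c (Suc (Suc n)) dvd sphere (Suc n) * b (Suc n)" using s by (metis dvd_triv_left)
    show "sphere (Suc (Suc n)) = sphere (Suc n) * b (Suc n) div c (Suc (Suc n))"
      using c_pos[of "Suc (Suc n)"] Suc.prems by (simp flip: s)
    show "Q (Suc (Suc n)) = (2 - int k + int (b (Suc n)) + int (c (Suc (Suc n)))) * Q (Suc n)
      - int (b (Suc n)) * int (c (Suc n)) * Q n" by simp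
  qed
  then have "(b (Suc n) # ?B, c (Suc (Suc n)) # ?C, Q (Suc n), Q (Suc (Suc n)), sphere (Suc (Suc n)))
    \<in> set (partial_arrays k (Suc n))"
    using Suc.IH Suc.prems by (simp only: partial_arrays.simps set_concat set_map) (auto simp del: extend.simps)
  then show ?case by simp
qed

lemma small_valency:
  assumes "k \<le> 4"
  shows "(bs, cs) \<in> set small_arrays"
proof -
  have k: "k \<in> set [3, 4]" using k3 assms by auto
  have "D \<le> 5"
  proof (rule ccontr)
    assume "\<not> D \<le> 5"
    then have "partial_arrays k 5 \<noteq> []" using in_partial_arrays[of 5] by auto
    then show False using partial_arrays_empty k unfolding list_all_iff by blast
  qed
  then have D: "D - 1 \<in> set [2, 3, 4]" "Suc (D - 1) = D" using diam3 by auto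
  have "(rev bs, rev cs, Q (D - 1), Q D, sphere D) \<in> set (partial_arrays k (D - 1))"
  proof -
    have "D - 1 < D" using diam3 by simp
    from in_partial_arrays[OF this] show ?thesis unfolding D(2) bs_eq[symmetric] cs_eq[symmetric] .
  qed
  then have "(rev (rev bs), rev (rev cs)) \<in> set small_arrays"
    using partial_arrays_small k D(1) unfolding list_all_iff by fast
  then show ?thesis by simp
qed

lemma Q_2_eq: "Q 2 = 3 * int (c 2) + 4 - int k - 2 * int (a 1)"
  using abc[of 1] diam3 by (simp add: numeral_2_eq_2)

lemma Q_3_eq: "Q 3 = (2 - int k + int (b 2) + int (c 3)) * Q 2 - 3 * int (b 2) * int (c 2)"
  by (simp add: numeral_3_eq_3 numeral_2_eq_2)

lemma Q_4_eq: "Q 4 = (2 - int k + int (b 3) + int (c 4)) * Q 3 - int (b 3) * int (c 3) * Q 2"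
  by (simp add: numeral_eq_Suc)

text \<open>For k \<ge> 5, \<open>Q 2\<close> is less than 3 c_2. Then \<open>Q 3 \<ge> 0\<close>
  forces (2 - k + c_3) \<open>Q 2\<close> > 0, so c_3 \<ge> k - 1. If D were larger than 3, then b_3
  = 1 and c_3 = k - 1, so \<open>Q 3 < Q 2\<close>, while \<open>Q 4 \<ge> 0\<close> requires (k -
  1) \<open>Q 2\<close> \<le> 3 \<open>Q 3\<close>.\<close>

lemma large_valency:
  assumes k5: "k \<ge> 5"
  shows "D = 3" and "c 3 = k \<or> c 3 = k - 1"
proof -
  have D: "1 < D" "2 < D" "3 \<le> D" using diam3 by auto
  have b2: "b 2 \<ge> 1" and c2: "c 2 \<ge> 1" and c3: "c 3 \<le> k" using b_pos c_pos abc[of 3] D by auto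
  have Q2: "Q 2 > 0" "Q 2 < 3 * int (c 2)" using Q_pos'(1)[of 2] D k5 Q_2_eq by auto
  have Q3: "Q 3 \<ge> 0" using Q_pos'(1)[of 3] Q_pos'(2) D by (cases "D = 3") auto
  have bQ: "int (b 2) * Q 2 < 3 * int (b 2) * int (c 2)" using Q2 b2 by simp
  then have "int (b 2) * Q 2 < (2 - int k + int (b 2) + int (c 3)) * Q 2" using Q3 Q_3_eq by linarith
  then have "0 < (2 - int k + int (c 3)) * Q 2" by (simp add: algebra_simps)
  then have "int (c 3) > int k - 2" using Q2 by (simp add: zero_less_mult_iff)
  then show c3': "c 3 = k \<or> c 3 = k - 1" using c3 by auto
  show "D = 3"
  proof (rule ccontr)
    assume "D \<noteq> 3"
    then have D4: "3 < D" "4 \<le> D" using D by auto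
    have "b 3 \<ge> 1" "b 3 + c 3 \<le> k" using b_pos[of 3] abc[of 3] D4 by auto
    then have b3: "b 3 = 1" and c3: "int (c 3) = int k - 1" using c3' k5 by auto
    have "Q 3 > 0" using Q_pos'(1)[of 3] D4 by simp
    have "Q 4 \<ge> 0" using Q_pos'(1)[of 4] Q_pos'(2) D4 by (cases "D = 4") auto
    have "c 4 \<le> k" using abc[of 4] D4 by simp
    then have "(2 - int k + int (b 3) + int (c 4)) * Q 3 \<le> 3 * Q 3"
      using \<open>Q 3 > 0\<close> b3 by (intro mult_right_mono) auto
    then have le: "(int k - 1) * Q 2 \<le> 3 * Q 3" using \<open>Q 4 \<ge> 0\<close> Q_4_eq b3 c3 by simp
    have "Q 3 < Q 2" using bQ Q_3_eq c3 by (simp add: algebra_simps)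
    moreover have "4 * Q 2 \<le> (int k - 1) * Q 2" using Q2 k5 by (intro mult_right_mono) auto
    ultimately show False using le Q2 by linarith
  qed
qed

text \<open>The array of K_{k+1,k+1} minus a perfect matching. Its eigenvalues other than k are 1,
  -1 and -k, none of which exceeds 1.\<close>

lemma no_crown:
  assumes D: "D = 3" and v: "b 1 = k - 1" "b 2 = 1" "c 2 = k - 1" "c 3 = k"
  shows False
proof -
  obtain \<theta> where \<theta>: "adj_eigenvalue V E \<theta>" "1 < \<theta>" "\<theta> < k" using ex_gt_1 by blast
  have "F \<theta> 3 = 0" using eigenvalue_F[OF \<theta>(1)] \<theta>(3) D by simp
  have a: "a 1 = 0" "a 2 = 0" using abc[of 1] abc[of 2] v D k3 by auto
  define v2 v3 where "v2 = vs \<theta> 2" and "v3 = vs \<theta> 3"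
  have k1: "real k - 1 > 0" using k3 by simp
  have "(real k - 1) * v2 = \<theta>\<^sup>2 - k"
    using vs_step[of 0 \<theta>] D a v k3 unfolding v2_def
    by (simp add: numeral_2_eq_2 power2_eq_square k_def[symmetric] of_nat_diff)
  moreover have "k * v3 = \<theta> * v2 - (real k - 1) * \<theta>"
    using vs_step[of 1 \<theta>] D a v k3 unfolding v2_def v3_def
    by (simp add: numeral_2_eq_2 numeral_3_eq_3 of_nat_diff)
  moreover have "1 + \<theta> + v2 + v3 = 0"
    using \<open>F \<theta> 3 = 0\<close> unfolding F_def v2_def v3_def by (simp add: numeral_2_eq_2 numeral_3_eq_3)
  ultimately have "(\<theta>\<^sup>2 - 1) * (\<theta> + k) = 0" by algebra
  moreover have "\<theta>\<^sup>2 > 1" using \<theta>(2) by (simp add: one_less_power)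
  ultimately show False using \<theta> by simp
qed

text \<open>These parameters are those of antipodal triple covers of complete graphs; the bound is the Krein
  condition for an eigenvalue that is at most - k / 2.\<close>
lemma triple_cover_bound:
  assumes D: "D = 3" and v: "b 1 = 2 * c 2" "b 2 = 1" "c 3 = k" and a1: "a 1 \<le> 1"
  shows "k \<le> 8"
proof -
  have c2: "c 2 \<ge> 1" using c_pos D by simp
  have ka: "k = 1 + a 1 + 2 * c 2" "k = a 2 + 1 + c 2" using abc[of 1] abc[of 2] v D by auto
  have "sphere 2 = 2 * k" "sphere 3 = 2"
  proof -
    have "c 2 * sphere 2 = c 2 * (2 * k)"
      using sphere_rec[of 1] sphere_1 v D by (simp add: numeral_2_eq_2 algebra_simps)
    then show s2: "sphere 2 = 2 * k" using c2 by simp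
    have "c 3 * sphere 3 = b 2 * sphere 2" using sphere_rec[of 2] D by simp
    then have "k * sphere 3 = k * 2" by (simp only: s2 v mult_1 mult.commute)
    then show "sphere 3 = 2" using k3 by simp
  qed
  then have kk: "kk 0 = 1" "kk 1 = k" "kk 2 = 2 * real k" "kk 3 = 2"
    using kk_sphere[of 2] kk_sphere[of 3] D by (simp_all add: kk_def)
  define \<delta> where "\<delta> = real (a 1) - real (c 2)"
  \<comment> \<open>The roots of \<open>p\<close> are the eigenvalues of such a cover other than k
    and -1.\<close>
  define p where "p x = x\<^sup>2 - \<delta> * x - k" for x :: real
  have kr: "real k = 1 + real (a 1) + 2 * real (c 2)" using ka(1) by linarith
  \<comment> \<open>The value of \<open>p\<close> at - k / 2 is 3 k (a_1 - 1) / 4, so a_1 \<le> 1 is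
    what places a root at or below - k / 2.\<close>
  have "\<exists>x\<ge>- real k. x \<le> - real k / 2 \<and> p x = 0"
  proof (rule IVT2')
    have "p (- real k / 2) = real k * (3 * real (a 1) - 3) / 4"
      unfolding p_def \<delta>_def kr by (simp add: power2_eq_square field_simps)
    also have "\<dots> \<le> 0" using a1 by (simp add: mult_nonneg_nonpos)
    finally show "p (- real k / 2) \<le> 0" .
    have "p (- real k) = real k * (2 * real (a 1) + real (c 2))"
      unfolding p_def \<delta>_def by (simp add: power2_eq_square kr algebra_simps)
    then show "0 \<le> p (- real k)" by simp
    show "continuous_on {- real k..- real k / 2} p" unfolding p_def by (intro continuous_intros)
  qed simp
  then obtain \<theta> where \<theta>: "\<theta> \<le> - real k / 2" "p \<theta> = 0" by blast
  have sq: "\<theta> * \<theta> = \<delta> * \<theta> + k" using \<theta>(2) by (simp add: p_def power2_eq_square)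
  have "c 2 * vs \<theta> 2 = (\<theta> - a 1) * \<theta> - k"
    using vs_step[of 0 \<theta>] D by (simp add: numeral_2_eq_2 k_def)
  also have "\<dots> = c 2 * (- \<theta>)" using sq by (simp add: \<delta>_def algebra_simps)
  finally have v2: "vs \<theta> 2 = - \<theta>"
    using c2 by (metis mult_left_cancel of_nat_eq_0_iff not_one_le_zero)
  have "k * vs \<theta> 3 = (\<theta> - a 2) * vs \<theta> 2 - b 1 * \<theta>"
    using vs_step[of 1 \<theta>] D v by (simp add: numeral_2_eq_2 numeral_3_eq_3)
  also have "\<dots> = real k * (- 1 :: real)"
  proof -
    have "real (a 2) = real (a 1) + real (c 2)" using ka by linarith
    then show ?thesis using sq v unfolding v2 by (simp add: \<delta>_def algebra_simps)
  qed
  finally have v3: "vs \<theta> 3 = - 1"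
    using k3 by (metis mult_left_cancel of_nat_eq_0_iff not_numeral_le_zero)
  have sum3: "(\<Sum>i\<le>3. f i) = f 0 + f 1 + f 2 + f 3" for f :: "nat \<Rightarrow> real"
    by (simp add: numeral_3_eq_3 numeral_2_eq_2)
  have "F \<theta> D = 0" unfolding D F_def sum3 v2 v3 by simp
  \<comment> \<open>The values 1, theta, - theta, - 1 over the sphere sizes 1, k, 2 k, 2 give the
    cosines 1, theta / k, - theta / (2 k), - 1 / 2.\<close>
  from krein[OF this] have "1 + (\<theta> / k) ^ 3 * k + (- \<theta> / (2 * k)) ^ 3 * (2 * k) + (- 1 / 2) ^ 3 * 2 \<ge> 0"
    unfolding D sum3 u_def kk v2 v3 by simp
  also have "\<dots> = 3 / 4 * (1 + \<theta> ^ 3 / (real k)\<^sup>2)"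
    using k3 by (simp add: field_simps power2_eq_square power3_eq_cube)
  finally have "1 + \<theta> ^ 3 / (real k)\<^sup>2 \<ge> 0" by simp
  then have "- (\<theta> ^ 3) \<le> (real k)\<^sup>2" using k3 by (simp add: field_simps)
  moreover have "(real k / 2) ^ 3 \<le> (- \<theta>) ^ 3" using \<theta>(1) by (intro power_mono) auto
  ultimately have "(real k / 2) ^ 3 \<le> (real k)\<^sup>2" by simp
  then have "real k * (real k)\<^sup>2 \<le> 8 * (real k)\<^sup>2"
    by (simp add: power2_eq_square power3_eq_cube)
  moreover have "(real k)\<^sup>2 > 0" using k3 by simp
  ultimately show "k \<le> 8" by simp
qed

lemma diameter3:
  assumes D: "D = 3" 
  shows "bs = [k, b 1, b 2]" "cs = [1, c 2, c 3]"
  using bs_eq cs_eq unfolding D by (simp_all add: numeral_3_eq_3 numeral_2_eq_2 k_def upt_rec)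

text \<open>With c_2 = b_1 = k - 1 - a_1 the inequality reads 4 a_1 \<le> k + 2. Together with k + 1
  \<le> 3 a_1 it would give a_1 \<le> 1 and k \<le> 2; for a_1 = 0 the array is that of
  \<open>no_crown\<close>.\<close>

lemma taylor_impossible:
  assumes D: "D = 3" and v: "b 1 = c 2" "b 2 = 1" "c 3 = k"
    and ineq: "3 * (k + 2 * a 1) \<le> 6 * c 2 + 12"
  shows False
proof (cases "a 1 = 0")
  case True
  then have "b 1 = k - 1" using abc[of 1] D by simp
  then show ?thesis using no_crown[OF D] v by simp
next
  case False
  then have "k + 1 \<le> 3 * a 1" using taylor_bound[OF D] v by simp
  then show ?thesis using ineq abc[of 1] v D k3 by simp
qed

lemma walk_equations:
  assumes D: "D = 3"
  shows "\<exists>n. a 2 * b 2 + b 2 * a 3 = a 1 * b 2 + c 2 * n"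
    and "\<exists>n. c 3 * b 2 + a 3 * a 3 = k + a 1 * a 3 + c 2 * n"
    and "\<exists>n. b 1 * a 2 = c 2 * n"
proof -
  have b3: "b 3 = 0" using b_D unfolding D .
  show "\<exists>n. a 2 * b 2 + b 2 * a 3 = a 1 * b 2 + c 2 * n"
    using two_walks[of 2 3] D by (simp add: P_def)
  show "\<exists>n. c 3 * b 2 + a 3 * a 3 = k + a 1 * a 3 + c 2 * n"
    using two_walks[of 3 3] D b3 by (simp add: P_def)
  show "\<exists>n. b 1 * a 2 = c 2 * n"
    using two_walks[of 1 2] D by (simp add: P_def numeral_2_eq_2)
qed

lemma classification_large:
  assumes k5: "k \<ge> 5"
  shows "(bs, cs) \<in> admissible_arrays"
proof -
  note D = large_valency(1)[OF k5]
  have arrays: "(bs, cs) = ([k, b 1, b 2], [1, c 2, c 3])" using diameter3[OF D] by simp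
  obtain n1 n2 n3 where n: "a 2 * b 2 + b 2 * a 3 = a 1 * b 2 + c 2 * n1"
    "c 3 * b 2 + a 3 * a 3 = k + a 1 * a 3 + c 2 * n2" "b 1 * a 2 = c 2 * n3"
    using walk_equations[OF D] by blast
  have k1: "k = 1 + a 1 + b 1" and k2: "k = a 2 + b 2 + c 2" and k3': "k = a 3 + c 3"
    using abc[of 1] abc[of 2] abc[of 3] b_D D by auto
  have b2: "b 2 \<ge> 1" and c2: "c 2 \<ge> 1" using b_pos c_pos D by auto
  have s2: "k * b 1 = c 2 * sphere 2" and s3: "sphere 2 * b 2 = c 3 * sphere 3"
    using sphere_rec[of 1] sphere_rec[of 2] sphere_1 D
    by (simp_all add: numeral_2_eq_2 numeral_3_eq_3 mult.commute)
  have "Q 3 \<ge> 0" using Q_pos'(2) D by simp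
  then have Q3: "3 * int (b 2) * int (c 2)
      \<le> (2 - int k + int (b 2) + int (c 3)) * (3 * int (c 2) + 4 - int k - 2 * int (a 1))"
    using Q_3_eq Q_2_eq by simp
  from large_valency(2)[OF k5] show ?thesis
  proof
    assume c3: "c 3 = k"
    then have a3: "a 3 = 0" using k3' by simp
    have "int ((2 + b 2) * (k + 2 * a 1)) \<le> int (6 * c 2 + 4 * (2 + b 2))"
      using Q3 c3 by (simp add: algebra_simps)
    then have ineq: "(2 + b 2) * (k + 2 * a 1) \<le> 6 * c 2 + 4 * (2 + b 2)" by (simp only: of_nat_le_iff)
    have e1: "a 2 * b 2 = a 1 * b 2 + c 2 * n1" using n(1) a3 by simp
    have e2: "k * b 2 = k + c 2 * n2" using n(2) unfolding a3 c3 by simp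
    have s3': "sphere 2 * b 2 = k * sphere 3" using s3 unfolding c3 .
    from arithmetic_1[OF k5 k1 k2 b2 c2 ineq e1 e2 n(3) s2 s3'] show ?thesis
    proof (elim disjE)
      assume "b 2 = 1 \<and> b 1 = c 2"
      then show ?thesis using taylor_impossible[OF D] c3 ineq by simp
    next
      assume cover: "b 2 = 1 \<and> b 1 = 2 * c 2 \<and> a 1 \<le> 1"
      then have "k \<le> 8" using triple_cover_bound[OF D] c3 by blast
      have "k = 1 + a 1 + 2 * c 2" using k1 cover by simp
      then have "c 2 \<in> {2, 3}" "a 1 \<in> {0, 1}" using \<open>k \<le> 8\<close> k5 cover by auto
      \<comment> \<open>Of these four covers three have a nonintegral multiplicity; the last is
        admissible.\<close>
      then have "(k, b 1, b 2, c 2) \<in> {(5,4,1,2), (6,4,1,2), (7,6,1,3), (8,6,1,3)}"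
        using \<open>k = 1 + a 1 + 2 * c 2\<close> cover by auto
      then show ?thesis using arrays c3 multiplicity_excludes
        by (elim insertE emptyE Pair_inject) (simp_all add: admissible_arrays_def)
    next
      assume "(k, b 1, b 2, c 2) \<in> {(5,4,2,1), (5,4,3,1), (5,4,3,2), (5,4,4,1), (6,5,2,2),
        (6,5,3,3), (6,5,4,2), (7,6,4,3), (8,7,4,4), (9,8,3,6), (10,9,4,6), (16,15,4,12), (7,6,1,2),
        (10,9,1,3), (5,4,1,1), (6,5,1,1)}"
      then show ?thesis using arrays c3 multiplicity_excludes
        by (elim insertE emptyE Pair_inject) (simp_all add: admissible_arrays_def)
    qed
  next
    assume c3: "c 3 = k - 1"
    then have a3: "a 3 = 1" using k3' k5 by simp
    have "int ((1 + b 2) * (k + 2 * a 1)) \<le> int (3 * c 2 + 4 * (1 + b 2))"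
      using Q3 c3 k5 by (simp add: of_nat_diff algebra_simps)
    then have ineq: "(1 + b 2) * (k + 2 * a 1) \<le> 3 * c 2 + 4 * (1 + b 2)" by (simp only: of_nat_le_iff)
    have e1: "a 2 * b 2 + b 2 = a 1 * b 2 + c 2 * n1" using n(1) a3 by simp
    have e2: "(k - 1) * b 2 + 1 = k + a 1 + c 2 * n2" using n(2) unfolding a3 c3 by simp
    have s3': "sphere 2 * b 2 = (k - 1) * sphere 3" using s3 unfolding c3 .
    from arithmetic_2[OF k5 k1 k2 b2 c2 ineq e1 e2 n(3) s2 s3'] show ?thesis
      using arrays c3 multiplicity_excludes
      by (elim insertE emptyE Pair_inject) (simp_all add: admissible_arrays_def)
  qed
qed

lemma classification_small:
  assumes "k \<le> 4"
  shows "(bs, cs) \<in> admissible_arrays"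
proof -
  \<comment> \<open>Small arrays removed without multiplicities: two have the form in
    \<open>no_crown\<close>, two violate the Taylor bound, and in four c_2 fails to divide a walk
    count.\<close>
  let ?X = "{([3, 1, 1], [1, 1, 3]), ([3, 2, 1], [1, 2, 3]), ([4, 2, 1], [1, 2, 4]), ([4, 2, 2], [1, 2, 4]),
    ([4, 3, 1], [1, 2, 2]), ([4, 3, 1], [1, 2, 3]), ([4, 3, 2], [1, 2, 3]), ([4, 3, 1], [1, 3, 4])}"
  have "(bs, cs) \<notin> ?X"
  proof
    assume X: "(bs, cs) \<in> ?X"
    then have D: "D = 3" by auto
    have arrays: "(bs, cs) = ([k, b 1, b 2], [1, c 2, c 3])" using diameter3[OF D] by simp
    have "([k, b 1, b 2], [1, c 2, c 3]) \<in> ?X" using X by (subst arrays[symmetric])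
    then have vals: "(k, b 1, b 2, c 2, c 3) \<in> {(3,1,1,1,3), (3,2,1,2,3), (4,2,1,2,4), (4,2,2,2,4), (4,3,1,2,2),
      (4,3,1,2,3), (4,3,2,2,3), (4,3,1,3,4)}" by simp
    have k12: "k = 1 + a 1 + b 1" "k = a 2 + b 2 + c 2" "k = a 3 + c 3"
      using abc[of 1] abc[of 2] abc[of 3] b_D D by auto
    have crown: "\<not> (b 1 = k - 1 \<and> b 2 = 1 \<and> c 2 = k - 1 \<and> c 3 = k)" using no_crown[OF D] by blast
    have taylor: "c 3 = k \<Longrightarrow> b 2 = 1 \<Longrightarrow> c 2 = b 1 \<Longrightarrow> a 1 \<ge> 1 \<Longrightarrow> k + 1 \<le> 3 * a 1"
      using taylor_bound[OF D] .
    obtain n1 n2 n3 where n: "a 2 * b 2 + b 2 * a 3 = a 1 * b 2 + c 2 * n1"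
      "c 3 * b 2 + a 3 * a 3 = k + a 1 * a 3 + c 2 * n2" "b 1 * a 2 = c 2 * n3"
      using walk_equations[OF D] by blast
    from vals show False
      by (elim insertE emptyE Pair_inject; insert k12 crown taylor n; simp; presburger?)
  qed
  moreover note multiplicity_excludes
  ultimately show ?thesis using small_valency[OF assms] unfolding small_arrays_def list.set
    by (elim insertE emptyE) (simp_all add: admissible_arrays_def)
qed

end

theorem theorem4p3:
  fixes V :: "'a set" and E :: "'a \<Rightarrow> 'a \<Rightarrow> bool" and bs cs :: "nat list"
  assumes "simple_graph V E"
    and "graph_connected V E"
    and "distance_regular_array V E bs cs"
    and "bs ! 0 \<ge> 3"
    and "length bs \<ge> 3"
    and "\<exists>\<theta>1. adj_eigenvalue V E \<theta>1 \<and> \<theta>1 < real (bs ! 0) \<and>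
           (\<forall>\<mu>. adj_eigenvalue V E \<mu> \<and> \<mu> < real (bs ! 0) \<longrightarrow> \<mu> \<le> \<theta>1) \<and>
           1 < \<theta>1 \<and> \<theta>1 \<le> 2"
  shows "(bs, cs) \<in> {
    ([3,2,2], [1,1,3]), ([4,3,2], [1,2,4]), ([4,3,3], [1,1,4]), ([5,4,3], [1,2,5]),
    ([5,4,4], [1,1,5]), ([6,5,3], [1,3,6]), ([6,5,4], [1,2,6]), ([7,6,4], [1,3,7]),
    ([8,7,4], [1,4,8]), ([9,8,3], [1,6,9]), ([10,9,4], [1,6,10]), ([16,15,4], [1,12,16]),
    ([3,2,2,1], [1,1,2,3]), ([3,2,2,2], [1,1,1,3]), ([4,3,2,1], [1,2,3,4]),
    ([4,3,3,1], [1,1,3,4]), ([3,2,2,1,1], [1,1,2,2,3]), ([4,2,1], [1,1,4]),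
    ([4,3,3], [1,1,2]), ([5,4,2], [1,1,4]), ([6,5,1], [1,1,6]), ([8,6,1], [1,3,8]),
    ([3,2,2,1], [1,1,1,2])}"
proof -
  interpret distance_regular V E bs cs using assms by unfold_locales
  have k: "k = bs ! 0" using assms(5) by (auto simp: k_def b_def)
  interpret small_second_eigenvalue V E bs cs
  proof
    show "k \<ge> 3" using assms(4) k by simp
    show "\<mu> \<le> 2" if "adj_eigenvalue V E \<mu>" "\<mu> < k" for \<mu>
      using assms(6) that unfolding k by fastforce
    show "\<exists>\<theta>. adj_eigenvalue V E \<theta> \<and> 1 < \<theta> \<and> \<theta> < k" using assms(6) unfolding k by blast
  qed
  have "(bs, cs) \<in> admissible_arrays"
    using classification_large classification_small by (cases "k \<ge> 5") auto
  then show ?thesis unfolding admissible_arrays_def .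
qed

end
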